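(* For every integer $d\ge 4$ there exists an infinite family of $d$-dimensional convex polytopes $P_n$, $n\ge 1$, such that $P_n$ has exactly $12(n+1)+d-4$ vertices (so the $P_n$ are pairwise combinatorially distinct) and \[\dim \mathcal{RS}(P_n)\le 76+d(d+1)\quad\text{for all } n\ge 1.\]
   Context: For a convex $d$-polytope $P$ with vertices labelled $1,\dots,N$ ($N=f_0(P)$), the realization space $\mathcal{RS}(P)$ is the set of all $V\in (S^d)^N$ such that $\mathrm{conv}(V)$ (a spherical polytope, i.e. lying in an open hemisphere of the unit sphere $S^d$) realizes $P$, i.e. there is an isomorphism of face lattices between $P$ and $\mathrm{conv}(V)$ respecting the vertex labelling. It is a semialgebraic set, so its dimension is well defined. *)

theory Defs
  imports "HOL-Analysis.Analysis"
begin

section \<open>Face lattices and combinatorial equivalence\<close>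

definition vertices :: "'a::euclidean_space set \<Rightarrow> 'a set" where
  "vertices P = {v. v extreme_point_of P}"

text \<open>Both the empty face and the polytope itself are included.\<close>

definition face_lattice :: "'a::euclidean_space set \<Rightarrow> 'a set set" where
  "face_lattice P = {F. F face_of P}"

definition lattice_iso :: "('a set \<Rightarrow> 'b set) \<Rightarrow> 'a set set \<Rightarrow> 'b set set \<Rightarrow> bool" where
  "lattice_iso \<phi> L M \<longleftrightarrow>
     bij_betw \<phi> L M \<and> (\<forall>F\<in>L. \<forall>G\<in>L. F \<subseteq> G \<longleftrightarrow> \<phi> F \<subseteq> \<phi> G)"

definition comb_equivalent :: "'a::euclidean_space set \<Rightarrow> 'b::euclidean_space set \<Rightarrow> bool" where
  "comb_equivalent P Q \<longleftrightarrow> (\<exists>\<phi>. lattice_iso \<phi> (face_lattice P) (face_lattice Q))"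


section \<open>Spherical polytopes\<close>

definition in_open_hemisphere :: "'a::euclidean_space set \<Rightarrow> bool" where
  "in_open_hemisphere V \<longleftrightarrow> V \<subseteq> sphere 0 1 \<and> (\<exists>a. \<forall>v\<in>V. 0 < a \<bullet> v)"

definition spherical_hull :: "'a::euclidean_space set \<Rightarrow> 'a set" where
  "spherical_hull V = sphere 0 1 \<inter> conic hull (convex hull V)"

text \<open>
  Faces of a spherical polytope are its intersections with supporting great hyperspheres.
  The choice \<open>a = 0\<close> gives the polytope itself; the empty face arises from the open
  hemisphere containing the polytope.
\<close>

definition spherical_face_lattice :: "'a::euclidean_space set \<Rightarrow> 'a set set" where
  "spherical_face_lattice Q =
     {F. \<exists>a. Q \<subseteq> {x. a \<bullet> x \<le> 0} \<and> F = Q \<inter> {x. a \<bullet> x = 0}}"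


section \<open>Realization spaces\<close>

definition vertex_labelling :: "'a::euclidean_space set \<Rightarrow> (nat \<Rightarrow> 'a) \<Rightarrow> bool" where
  "vertex_labelling P p \<longleftrightarrow> bij_betw p {1..card (vertices P)} (vertices P)"

text \<open>
  For \<open>P\<close> in \<open>real ^ 'n\<close> with \<open>CARD('n) = d\<close>, the sphere \<open>S\<^sup>d\<close> is the unit sphere of the
  \<open>(d + 1)\<close>-dimensional Euclidean space \<open>(real ^ 'n) \<times> real\<close>. Points of \<open>(S\<^sup>d)\<^sup>N\<close> are
  extensional functions on \<open>{1..N}\<close>.
\<close>

definition realization_space ::
    "(real ^ 'n) set \<Rightarrow> (nat \<Rightarrow> real ^ 'n) \<Rightarrow> (nat \<Rightarrow> (real ^ 'n) \<times> real) set" where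
  "realization_space P p =
     {V \<in> {1..card (vertices P)} \<rightarrow>\<^sub>E sphere 0 1.
        in_open_hemisphere (V ` {1..card (vertices P)}) \<and>
        (\<exists>\<phi>. lattice_iso \<phi> (face_lattice P)
               (spherical_face_lattice (spherical_hull (V ` {1..card (vertices P)}))) \<and>
             (\<forall>i\<in>{1..card (vertices P)}. \<phi> {p i} = {V i}))}"


section \<open>Semialgebraic sets and their dimension\<close>

text \<open>
  The real polynomial functions in a given set \<open>C\<close> of coordinate functions, and the
  semialgebraic subsets of the space \<open>X\<close> with these coordinates: the smallest Boolean
  algebra of subsets of \<open>X\<close> containing all \<open>{p > 0}\<close>.
\<close>

inductive_set poly_funs :: "('x \<Rightarrow> real) set \<Rightarrow> ('x \<Rightarrow> real) set"
  for C :: "('x \<Rightarrow> real) set" where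
  const: "(\<lambda>_. c) \<in> poly_funs C"
| coord: "f \<in> C \<Longrightarrow> f \<in> poly_funs C"
| add: "f \<in> poly_funs C \<Longrightarrow> g \<in> poly_funs C \<Longrightarrow> (\<lambda>x. f x + g x) \<in> poly_funs C"
| mult: "f \<in> poly_funs C \<Longrightarrow> g \<in> poly_funs C \<Longrightarrow> (\<lambda>x. f x * g x) \<in> poly_funs C"

inductive_set semialgebraic_sets :: "'x set \<Rightarrow> ('x \<Rightarrow> real) set \<Rightarrow> 'x set set"
  for X :: "'x set" and C :: "('x \<Rightarrow> real) set" where
  pos: "p \<in> poly_funs C \<Longrightarrow> {x \<in> X. 0 < p x} \<in> semialgebraic_sets X C"
| union: "A \<in> semialgebraic_sets X C \<Longrightarrow> B \<in> semialgebraic_sets X C \<Longrightarrow>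
    A \<union> B \<in> semialgebraic_sets X C"
| compl: "A \<in> semialgebraic_sets X C \<Longrightarrow> X - A \<in> semialgebraic_sets X C"

text \<open>
  The affine space \<open>E\<^sup>I\<close> of families in a Euclidean space \<open>E\<close> indexed by \<open>I\<close>. Its subsets
  carry the subspace topology of the product topology on functions, which for finite \<open>I\<close>
  is the Euclidean one.
\<close>

definition family_space :: "nat set \<Rightarrow> (nat \<Rightarrow> 'a::euclidean_space) set" where
  "family_space I = I \<rightarrow>\<^sub>E UNIV"

definition family_coords :: "nat set \<Rightarrow> ((nat \<Rightarrow> 'a::euclidean_space) \<Rightarrow> real) set" where
  "family_coords I = {\<lambda>x. x i \<bullet> b | i b. i \<in> I \<and> b \<in> Basis}"

definition semialgebraic :: "nat set \<Rightarrow> (nat \<Rightarrow> 'a::euclidean_space) set \<Rightarrow> bool" where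
  "semialgebraic I A \<longleftrightarrow> A \<in> semialgebraic_sets (family_space I) (family_coords I)"

definition semialgebraic_map ::
    "nat set \<Rightarrow> nat set \<Rightarrow> (nat \<Rightarrow> 'a::euclidean_space) set \<Rightarrow>
     ((nat \<Rightarrow> 'a) \<Rightarrow> (nat \<Rightarrow> 'b::euclidean_space)) \<Rightarrow> bool" where
  "semialgebraic_map I J A f \<longleftrightarrow>
     {(x, f x) | x. x \<in> A} \<in>
       semialgebraic_sets (family_space I \<times> family_space J)
         ({c \<circ> fst | c. c \<in> family_coords I} \<union> {c \<circ> snd | c. c \<in> family_coords J})"

definition semialgebraic_homeomorphic ::
    "nat set \<Rightarrow> nat set \<Rightarrow> (nat \<Rightarrow> 'a::euclidean_space) set \<Rightarrow>
     (nat \<Rightarrow> 'b::euclidean_space) set \<Rightarrow> bool" where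
  "semialgebraic_homeomorphic I J A B \<longleftrightarrow>
     (\<exists>f g. homeomorphism A B f g \<and> semialgebraic_map I J A f \<and> semialgebraic_map J I B g)"

definition open_cube :: "nat \<Rightarrow> (nat \<Rightarrow> real) set" where
  "open_cube k = {1..k} \<rightarrow>\<^sub>E {0<..<1}"

text \<open>
  The dimension of a semialgebraic set is the largest dimension of a cell contained in it,
  a cell being a semialgebraic set that is semialgebraically homeomorphic to an open cube;
  equivalently, the largest dimension of a cell in any decomposition of the set into
  finitely many cells. Values are taken in \<open>enat\<close> so that the supremum is always
  meaningful; the empty set gets dimension \<open>0\<close>.
\<close>

definition semialgebraic_dim :: "nat set \<Rightarrow> (nat \<Rightarrow> 'a::euclidean_space) set \<Rightarrow> enat" where
  "semialgebraic_dim I S =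
     Sup {enat k | k. \<exists>T \<subseteq> S. semialgebraic I T \<and>
                       semialgebraic_homeomorphic {1..k} I (open_cube k) T}"

end

theory Submission
  imports Defs "HOL-Homology.Homology"
begin

text \<open>
  For \<open>d = 4\<close> the polytope \<open>P\<^sub>n\<close> is the convex hull of \<open>n + 1\<close> layers of 12 points, and its boundary
  contains a piece of the cubic tiling of \<open>\<int>\<^sup>3\<close>, wrapped around a torus: the tiling vertex
  \<open>(z\<^sub>1, z\<^sub>2, z\<^sub>3)\<close> lies in layer \<open>z\<^sub>1 + z\<^sub>2 + z\<^sub>3\<close> and is otherwise remembered only through
  \<open>z\<^sub>1\<close> modulo 4 and \<open>z\<^sub>2 - z\<^sub>3\<close> modulo 6. Every vertex \<open>w\<close> above the second layer is the top of three
  squares whose other vertices lie in the two preceding layers. In any realization these squares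
  span planes, and the three planes meet only in \<open>w\<close>, so by induction the 24 vertices of the first
  two layers determine all others. For \<open>d > 4\<close> one takes iterated pyramids: the \<open>d - 4\<close> apexes force
  the base vectors into a 5-dimensional subspace. Counting parameters, a cell in the realization
  space embeds into a space of dimension \<open>76 + d (d + 1)\<close>, and invariance of domain bounds its
  dimension.
\<close>

text \<open>Origin of the bound: 24 unit vectors in 5-space have 24 * 4 = 96 parameters. For d > 4
  the 5-dimensional subspace adds 5 (d - 4), and the apexes on the d-sphere add d (d - 4). The total
  is 76 + d (d + 1). The span of the base vectors may change its dimension over a realization space,
  so the count is made near a point of maximal rank in the given cell. The obstacle is convexity:
  for every n all cubes used must lie in the boundary and all their squares must be flat. Flatness
  fixes the growth of the layers by a recurrence with exponential solutions. Closing up the other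
  two directions makes support depend on residues and layers alone. On the two sheets of a cube it
  reduces to \<open>14 * 3 ^ l * t <= 15 ^ l + 27\<close>, where equality must hold exactly at the
  cube's own vertices. The combinatorics of a realization is used in one form throughout: the signs
  of linear functionals on the vertex vectors.\<close>

section \<open>Dimension of cells\<close>

text \<open>An open set survives a small change of the last coordinate alone. This excludes nonempty
  open images inside the coordinate hyperplane.\<close>

lemma Euclidean_space_openin_last_nonzero:
  assumes "openin (Euclidean_space (Suc m)) T" "y \<in> T"
  shows "\<exists>z\<in>T. z m \<noteq> 0"
proof -
  obtain O' where O': "open O'" "T = O' \<inter> topspace (Euclidean_space (Suc m))"
    using assms(1) unfolding Euclidean_space_def openin_subtopology
    by (auto simp: euclidean_product_topology)
  define c where "c = (\<lambda>t::real. y(m := t))"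
  have cont: "continuous_on UNIV c"
    unfolding c_def
  proof (intro continuous_on_coordinatewise_then_product)
    show "continuous_on UNIV (\<lambda>t. (y(m := t)) i)" for i
      by (cases "i = m") auto
  qed
  have "open (c -` O')"
    using cont O'(1) by (simp add: continuous_on_open_vimage)
  moreover have "c (y m) \<in> O'"
    using assms(2) O'(2) by (simp add: c_def)
  ultimately obtain e where e: "e > 0" "ball (y m) e \<subseteq> c -` O'"
    by (meson open_contains_ball vimage_eq)
  define t where "t = (if y m = 0 then e / 2 else y m)"
  have "t \<in> ball (y m) e" "t \<noteq> 0"
    using e(1) by (auto simp: t_def dist_real_def)
  then have "c t \<in> O'" using e(2) by auto
  moreover have "c t \<in> topspace (Euclidean_space (Suc m))"
    using assms(2) O'(2) by (auto simp: c_def topspace_Euclidean_space)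
  ultimately show ?thesis
    using O'(2) \<open>t \<noteq> 0\<close> by (intro bexI[of _ "c t"]) (auto simp: c_def)
qed

text \<open>If \<open>J\<close> were smaller than \<open>S\<close>, padding the coordinates
  \<open>F x j\<close> with zeros would give an injective continuous map from an open set of
  \<open>Euclidean_space m\<close>, \<open>m = card S\<close>, to that space. Its image is open by
  invariance of domain, yet the last coordinate vanishes on it.\<close>

lemma invariance_of_dimension_extensional:
  fixes F :: "('a \<Rightarrow> real) \<Rightarrow> ('b \<Rightarrow> real)"
  assumes "finite S" "finite J" "open W" and ne: "W \<inter> (S \<rightarrow>\<^sub>E UNIV) \<noteq> {}"
    and cont: "continuous_on (W \<inter> (S \<rightarrow>\<^sub>E UNIV)) F"
    and inj: "\<And>x y. \<lbrakk>x \<in> W \<inter> (S \<rightarrow>\<^sub>E UNIV); y \<in> W \<inter> (S \<rightarrow>\<^sub>E UNIV); \<And>j. j \<in> J \<Longrightarrow> F x j = F y j\<rbrakk> \<Longrightarrow> x = y"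
  shows "card S \<le> card J"
proof (rule ccontr)
  assume less: "\<not> card S \<le> card J"
  define m n where "m = card S" and "n = card J"
  have nm: "n < m" using less by (simp add: m_def n_def)
  obtain e where e: "bij_betw e S {0..<m}"
    using ex_bij_betw_finite_nat[OF \<open>finite S\<close>] by (auto simp: m_def)
  obtain e' where e': "bij_betw e' {0..<n} J"
    using ex_bij_betw_nat_finite[OF \<open>finite J\<close>] by (auto simp: n_def)
  define \<psi> where "\<psi> = (\<lambda>y::nat \<Rightarrow> real. restrict (\<lambda>s. y (e s)) S)"
  define U where "U = topspace (Euclidean_space m) \<inter> \<psi> -` W"
  define G where "G = (\<lambda>y i. if i < n then F (\<psi> y) (e' i) else 0)"
  have cont_\<psi>: "continuous_on A \<psi>" for A
    unfolding \<psi>_def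
  proof (intro continuous_on_coordinatewise_then_product)
    fix i show "continuous_on A (\<lambda>x. restrict (\<lambda>s. x (e s)) S i)"
      by (cases "i \<in> S") (auto intro: continuous_on_subset[OF continuous_on_product_coordinates])
  qed
  have \<psi>_ext: "\<psi> y \<in> S \<rightarrow>\<^sub>E UNIV" for y by (simp add: \<psi>_def)
  have U_open: "openin (Euclidean_space m) U"
  proof -
    have "open (\<psi> -` W)"
      using cont_\<psi>[of UNIV] \<open>open W\<close> by (simp add: continuous_on_open_vimage)
    then show ?thesis
      unfolding U_def Euclidean_space_def
      by (auto simp: euclidean_product_topology openin_subtopology)
  qed
  have \<psi>_inj: "y = z" if "y \<in> U" "z \<in> U" "\<psi> y = \<psi> z" for y z
  proof
    fix i show "y i = z i"
    proof (cases "i < m")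
      case True
      then obtain s where "s \<in> S" "e s = i"
        using e by (metis atLeastLessThan_iff bij_betw_iff_bijections zero_le)
      then show ?thesis using fun_cong[OF that(3), of s] by (simp add: \<psi>_def)
    next
      case False
      then show ?thesis using that by (auto simp: U_def topspace_Euclidean_space)
    qed
  qed
  have "inj_on G U"
  proof (rule inj_onI)
    fix y z assume yz: "y \<in> U" "z \<in> U" "G y = G z"
    have "\<psi> y = \<psi> z"
    proof (rule inj)
      fix j assume "j \<in> J"
      then obtain i where "i < n" "e' i = j"
        using e' by (metis atLeastLessThan_iff bij_betw_iff_bijections)
      then show "F (\<psi> y) j = F (\<psi> z) j"
        using fun_cong[OF yz(3), of i] by (simp add: G_def)
    qed (use yz \<psi>_ext in \<open>auto simp: U_def\<close>)
    then show "y = z" using \<psi>_inj yz by blast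
  qed
  moreover have "continuous_map (subtopology (Euclidean_space m) U) (Euclidean_space m) G"
  proof -
    have "continuous_on U (\<lambda>y. F (\<psi> y))"
      by (rule continuous_on_compose2[OF cont cont_\<psi>]) (use \<psi>_ext in \<open>auto simp: U_def\<close>)
    then have "continuous_on U G"
      unfolding G_def
    proof (intro continuous_on_coordinatewise_then_product)
      fix i assume "continuous_on U (\<lambda>y. F (\<psi> y))"
      then show "continuous_on U (\<lambda>y. if i < n then F (\<psi> y) (e' i) else 0)"
        by (cases "i < n") (auto dest: continuous_on_product_then_coordinatewise)
    qed
    moreover have "G \<in> U \<rightarrow> topspace (Euclidean_space m)"
      using nm by (auto simp: G_def topspace_Euclidean_space)
    moreover have "topspace (subtopology (Euclidean_space m) U) = U" by (auto simp: U_def)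
    ultimately show ?thesis
      unfolding cm_Euclidean_space_iff_continuous_on by simp
  qed
  ultimately have op: "openin (Euclidean_space m) (G ` U)"
    using U_open invariance_of_domain_Euclidean_space by blast
  have "U \<noteq> {}"
  proof -
    obtain w where w: "w \<in> W" "w \<in> S \<rightarrow>\<^sub>E UNIV" using ne by blast
    define y where "y = (\<lambda>i. if i < m then w (inv_into S e i) else 0)"
    have "\<psi> y = w"
    proof
      fix s show "\<psi> y s = w s"
        using e w(2) by (cases "s \<in> S") (auto simp: \<psi>_def y_def bij_betw_def)
    qed
    then have "y \<in> U" using w by (auto simp: U_def y_def topspace_Euclidean_space)
    then show ?thesis by blast
  qed
  then obtain y where "y \<in> G ` U" by blast
  moreover obtain m' where m': "m = Suc m'" using nm by (cases m) auto
  ultimately obtain z where "z \<in> G ` U" "z m' \<noteq> 0"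
    using Euclidean_space_openin_last_nonzero[of m' "G ` U" y] op by auto
  then show False using nm m' by (auto simp: G_def)
qed

lemma dual_vectors_exist:
  fixes v :: "'i \<Rightarrow> 'b::euclidean_space"
  assumes "independent (v ` J)" "inj_on v J"
  obtains g where "\<And>i j. i \<in> J \<Longrightarrow> j \<in> J \<Longrightarrow> g i \<bullet> v j = (if i = j then 1 else 0)"
proof -
  have "\<exists>w. \<forall>j\<in>J. w \<bullet> v j = (if i = j then 1 else 0)" if "i \<in> J" for i
  proof -
    obtain h :: "'b \<Rightarrow> real" where h: "linear h" "\<forall>b\<in>v ` J. h b = (if b = v i then 1 else 0)"
      using linear_independent_extend[OF assms(1), of "\<lambda>b. if b = v i then 1 else 0"] by blast
    \<comment> \<open>\<open>adjoint h 1\<close> is the vector that represents the functional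
      \<open>h\<close>.\<close>
    have "adjoint h 1 \<bullet> v j = (if i = j then 1 else 0)" if "j \<in> J" for j
    proof -
      have "adjoint h 1 \<bullet> v j = h (v j)"
        using adjoint_works[OF h(1), of "v j" 1] by (simp add: inner_commute)
      also have "\<dots> = (if i = j then 1 else 0)"
        using h(2) assms(2) \<open>i \<in> J\<close> that by (auto simp: inj_on_eq_iff)
      finally show ?thesis .
    qed
    then show ?thesis by blast
  qed
  then obtain g where "\<forall>i\<in>J. \<forall>j\<in>J. g i \<bullet> v j = (if i = j then 1 else 0)"
    by metis
  then show ?thesis using that by blast
qed

text \<open>The row belonging to a coefficient of largest absolute value \<open>m\<close> gives
  \<open>m <= m * card J / (card J + 1)\<close>, hence \<open>m = 0\<close>.\<close>

lemma near_identity_injective: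
  fixes c :: "'i \<Rightarrow> real"
  assumes "finite J"
    and M: "\<And>i j. i \<in> J \<Longrightarrow> j \<in> J \<Longrightarrow> \<bar>M i j - (if i = j then 1 else 0)\<bar> < 1 / (real (card J) + 1)"
    and z: "\<And>i. i \<in> J \<Longrightarrow> (\<Sum>j\<in>J. c j * M i j) = 0"
    and "i \<in> J"
  shows "c i = 0"
proof -
  define m where "m = Max ((\<lambda>j. \<bar>c j\<bar>) ` J)"
  have "m \<in> (\<lambda>j. \<bar>c j\<bar>) ` J"
    unfolding m_def using assms by (intro Max_in) auto
  then obtain i0 where i0: "i0 \<in> J" "\<bar>c i0\<bar> = m" by auto
  have le: "\<bar>c j\<bar> \<le> m" if "j \<in> J" for j
    unfolding m_def using assms that by (intro Max_ge) auto
  have "c i0 = (\<Sum>j\<in>J. c j * (if i0 = j then 1 else 0)) - (\<Sum>j\<in>J. c j * M i0 j)"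
    using z[OF i0(1)] i0(1) \<open>finite J\<close> by (simp add: if_distrib[of "\<lambda>t. _ * t"] cong: if_cong)
  also have "\<dots> = (\<Sum>j\<in>J. - (c j * (M i0 j - (if i0 = j then 1 else 0))))"
    unfolding sum_subtractf[symmetric] by (intro sum.cong) (auto simp: algebra_simps)
  finally have "m \<le> (\<Sum>j\<in>J. \<bar>- (c j * (M i0 j - (if i0 = j then 1 else 0)))\<bar>)"
    using i0(2) sum_abs by metis
  also have "\<dots> \<le> (\<Sum>j\<in>J. m * (1 / (real (card J) + 1)))"
  proof (intro sum_mono)
    fix j assume "j \<in> J"
    then have "\<bar>c j\<bar> * \<bar>M i0 j - (if i0 = j then 1 else 0)\<bar> \<le> m * (1 / (real (card J) + 1))"
      using less_imp_le[OF M[OF i0(1), of j]] le[of j] i0(2) by (intro mult_mono) auto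
    then show "\<bar>- (c j * (M i0 j - (if i0 = j then 1 else 0)))\<bar> \<le> m * (1 / (real (card J) + 1))"
      by (simp only: abs_minus_cancel abs_mult)
  qed
  finally have "m * (real (card J) + 1) \<le> m * real (card J)"
    by (simp add: field_simps)
  then have "m \<le> 0" by (simp add: algebra_simps)
  then show ?thesis using le[OF \<open>i \<in> J\<close>] by simp
qed

text \<open>
  Each unit vector \<open>f x i\<close> is replaced by its positive multiples, which trades the
  sphere for a linear space and costs one dimension per index on both sides. Near a point of
  maximal rank \<open>q\<close> the vectors indexed by \<open>I\<close> lie in the span of \<open>q\<close> of them, so each of
  the other vectors is described by only \<open>q\<close> coordinates.
\<close>

lemma cell_dimension_bound:
  fixes f :: "(nat \<Rightarrow> real) \<Rightarrow> (nat \<Rightarrow> 'b::euclidean_space)"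
  assumes fin: "finite I" "finite A" and disj: "I \<inter> A = {}"
    and cont: "continuous_on (open_cube k) f"
    and inj: "inj_on f (open_cube k)"
    and unit: "\<And>x i. x \<in> open_cube k \<Longrightarrow> i \<in> I \<union> A \<Longrightarrow> norm (f x i) = 1"
    and det: "\<And>x y. x \<in> open_cube k \<Longrightarrow> y \<in> open_cube k \<Longrightarrow>
                (\<And>i. i \<in> I \<union> A \<Longrightarrow> f x i = f y i) \<Longrightarrow> f x = f y"
    and rank: "\<And>x. x \<in> open_cube k \<Longrightarrow> dim (f x ` I) \<le> r"
  shows "\<exists>q\<le>r. q \<le> card I \<and>
           k + card I + card A \<le> (q + card A) * DIM('b) + (card I - q) * q"
proof -
  have "(\<lambda>i\<in>{1..k}. 1/2) \<in> open_cube k"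
    by (auto simp: open_cube_def)
  then have "\<exists>x. x \<in> open_cube k \<and> (\<forall>y. y \<in> open_cube k \<longrightarrow> dim (f y ` I) \<le> dim (f x ` I))"
    using Lattices_Big.ex_has_greatest_nat[of "\<lambda>x. x \<in> open_cube k" "\<lambda>i\<in>{1..k}. 1/2" "\<lambda>x. dim (f x ` I)" "Suc r"] rank
    by (simp add: le_imp_less_Suc)
  then obtain x0 where x0: "x0 \<in> open_cube k" and
    max: "\<And>y. y \<in> open_cube k \<Longrightarrow> dim (f y ` I) \<le> dim (f x0 ` I)"
    by blast
  define q where "q = dim (f x0 ` I)"
  obtain B where B: "B \<subseteq> f x0 ` I" "independent B" "f x0 ` I \<subseteq> span B" "card B = q"
    using basis_exists[of "f x0 ` I"] unfolding q_def by blast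
  obtain J where J: "J \<subseteq> I" "inj_on (f x0) J" "B = f x0 ` J"
    using B(1) by (auto simp: subset_image_inj)
  have finJ: "finite J" using J(1) fin finite_subset by blast
  have cardJ: "card J = q" using J B(4) by (simp add: card_image)
  obtain g where g: "\<And>i j. i \<in> J \<Longrightarrow> j \<in> J \<Longrightarrow> g i \<bullet> f x0 j = (if i = j then 1 else 0)"
    using dual_vectors_exist[of "f x0" J] B(2) J by blast
  define \<epsilon> where "\<epsilon> = 1 / (real (card J) + 1)"
  have "\<epsilon> > 0" by (simp add: \<epsilon>_def)
  \<comment> \<open>On this neighbourhood of \<open>x0\<close> the pairing of the vectors indexed by
    \<open>J\<close> with the dual family \<open>g\<close> stays close to the identity, so they
    remain independent.\<close>
  define Q where "Q = {x \<in> open_cube k. \<forall>p\<in>J \<times> J. \<bar>g (fst p) \<bullet> f x (snd p) - (if fst p = snd p then 1 else 0)\<bar> < \<epsilon>}"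
  have cont_i: "continuous_on (open_cube k) (\<lambda>x. f x i)" for i
    using cont by (rule continuous_on_product_then_coordinatewise)
  have "openin (top_of_set (open_cube k)) Q"
  proof -
    have Q_eq: "Q = open_cube k \<inter> (\<Inter>p\<in>J \<times> J. {x \<in> open_cube k. (\<bar>g (fst p) \<bullet> f x (snd p) - (if fst p = snd p then 1 else 0)\<bar>) \<in> {..<\<epsilon>}})"
      unfolding Q_def lessThan_iff by blast
    have "openin (top_of_set (open_cube k)) {x \<in> open_cube k. (\<bar>g (fst p) \<bullet> f x (snd p) - (if fst p = snd p then 1 else 0)\<bar>) \<in> {..<\<epsilon>}}" for p
      using continuous_openin_preimage_gen[of "open_cube k" "\<lambda>x. \<bar>g (fst p) \<bullet> f x (snd p) - (if fst p = snd p then 1 else 0)\<bar>" "{..<\<epsilon>}"]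
      by (simp add: vimage_def Int_def cont_i continuous_intros)
    then show ?thesis
      unfolding Q_eq using finJ
      by (cases "J = {}") (auto intro!: openin_Int openin_INT)
  qed
  then obtain O' where O': "open O'" "Q = open_cube k \<inter> O'"
    by (auto simp: openin_open)
  have "x0 \<in> Q" using x0 g \<open>\<epsilon> > 0\<close> by (auto simp: Q_def)
  have indep: "c i = 0" if "x \<in> Q" "i \<in> J" "\<And>i. i \<in> J \<Longrightarrow> g i \<bullet> (\<Sum>j\<in>J. c j *\<^sub>R f x j) = 0" for x c i
    using near_identity_injective[OF finJ, of "\<lambda>i j. g i \<bullet> f x j" c i] that
    by (auto simp: Q_def \<epsilon>_def inner_sum_right)
  have inj_fx: "inj_on (f x) J" if "x \<in> Q" for x
  proof (rule inj_onI, rule ccontr)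
    fix i j assume ij: "i \<in> J" "j \<in> J" "f x i = f x j" "i \<noteq> j"
    have "(\<Sum>l\<in>J. ((if l = i then 1 else 0) - (if l = j then 1 else 0)) *\<^sub>R f x l) = 0"
      using ij finJ by (simp add: scaleR_left_diff_distrib sum_subtractf if_distrib[of "\<lambda>t. t *\<^sub>R _"] cong: if_cong)
    then show False
      using indep[OF that ij(1), of "\<lambda>l. (if l = i then 1 else 0) - (if l = j then 1 else 0)"] ij
      by auto
  qed
  have sum_span: "\<exists>c. v = (\<Sum>j\<in>J. c j *\<^sub>R f x j)" if x: "x \<in> Q" and v: "v \<in> span (f x ` J)" for x v
  proof -
    obtain u where "v = (\<Sum>w\<in>f x ` J. u w *\<^sub>R w)"
      using v finJ by (auto simp: span_finite)
    then show ?thesis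
      using inj_fx[OF x] by (auto simp: sum.reindex)
  qed
  have inj_span: "v = 0" if "x \<in> Q" "v \<in> span (f x ` J)" "\<And>i. i \<in> J \<Longrightarrow> g i \<bullet> v = 0" for x v
  proof -
    obtain c where c: "v = (\<Sum>j\<in>J. c j *\<^sub>R f x j)" using sum_span[OF \<open>x \<in> Q\<close> \<open>v \<in> span (f x ` J)\<close>] by blast
    have "c j = 0" if "j \<in> J" for j using indep[of x j c] that \<open>x \<in> Q\<close> c \<open>\<And>i. i \<in> J \<Longrightarrow> g i \<bullet> v = 0\<close> by blast
    then show ?thesis using c by simp
  qed
  have indepQ: "independent (f x ` J)" if "x \<in> Q" for x
  proof (rule independent_if_scalars_zero)
    show "finite (f x ` J)" using finJ by simp
    fix u w assume u: "(\<Sum>w\<in>f x ` J. u w *\<^sub>R w) = 0" "w \<in> f x ` J"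
    then obtain j where j: "j \<in> J" "w = f x j" by auto
    have "(\<Sum>j\<in>J. u (f x j) *\<^sub>R f x j) = 0"
      using u(1) inj_fx[OF that] by (simp add: sum.reindex)
    then show "u w = 0" using indep[OF that j(1), of "\<lambda>j. u (f x j)"] j by simp
  qed
  \<comment> \<open>Maximality of the rank at \<open>x0\<close> enters here: \<open>q\<close>
    independent vectors already fill the span of all vectors indexed by \<open>I\<close>.\<close>
  have spanQ: "f x i \<in> span (f x ` J)" if "x \<in> Q" "i \<in> I" for x i
  proof -
    have x: "x \<in> open_cube k" using that by (simp add: Q_def)
    have "card (f x ` J) = q" using inj_fx[OF that(1)] cardJ by (simp add: card_image)
    then have "dim (f x ` I) \<le> card (f x ` J)" using max[OF x] by (simp add: q_def)
    then have "f x ` I \<subseteq> span (f x ` J)"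
      using indepQ[OF that(1)] J(1) card_ge_dim_independent[of "f x ` J" "f x ` I"] by blast
    then show ?thesis using that by blast
  qed
  \<comment> \<open>A point \<open>h\<close> carries cube coordinates under \<open>Inl\<close> and
    one positive scaling factor per index under \<open>Inr\<close>. \<open>F\<close> measures the
    scaled vectors: by all standard coordinates for indices in \<open>J\<close> and
    \<open>A\<close>, and by the pairings with \<open>g\<close> for those in
    \<open>I - J\<close>.\<close>
  define xx where "xx = (\<lambda>h :: nat + nat \<Rightarrow> real. restrict (\<lambda>i. h (Inl i)) {1..k})"
  define S where "S = Inl ` {1..k} \<union> Inr ` (I \<union> A)"
  define W where "W = xx -` O' \<inter> (\<Inter>i\<in>{1..k}. {h. h (Inl i) \<in> {0<..<1}}) \<inter> (\<Inter>i\<in>I \<union> A. {h. h (Inr i) \<in> {0<..}})"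
  define F where "F = (\<lambda>h p. h (Inr (fst p)) * (f (xx h) (fst p) \<bullet> (snd p :: 'b)))"
  define K where "K = (J \<union> A) \<times> Basis \<union> (I - J) \<times> g ` J"
  have cont_c: "continuous_on X (\<lambda>h :: nat + nat \<Rightarrow> real. h i)" for X i
    by (rule continuous_on_subset[OF continuous_on_product_coordinates]) simp
  have cont_xx: "continuous_on X xx" for X
    unfolding xx_def
  proof (intro continuous_on_coordinatewise_then_product)
    fix i show "continuous_on X (\<lambda>x. restrict (\<lambda>i. x (Inl i)) {1..k} i)"
      by (cases "i \<in> {1..k}") (auto intro: cont_c)
  qed
  have "open W"
  proof -
    have "open {h :: nat + nat \<Rightarrow> real. h i \<in> T}" if "open T" for i T
      using continuous_open_preimage[OF cont_c[of UNIV i] open_UNIV that] by (simp add: vimage_def)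
    moreover have "open (xx -` O')"
      using cont_xx[of UNIV] O'(1) by (simp add: continuous_on_open_vimage)
    ultimately show ?thesis
      unfolding W_def using fin
      by (intro open_Int open_INT ballI) (simp_all only: finite_Un finite_atLeastAtMost open_greaterThanLessThan open_greaterThan simp_thms)
  qed
  have WQ: "xx h \<in> Q" if "h \<in> W" for h
  proof -
    have "xx h \<in> open_cube k" using that by (auto simp: open_cube_def W_def xx_def)
    then show ?thesis using that O'(2) by (auto simp: W_def)
  qed
  have "card S \<le> card K"
  proof (rule invariance_of_dimension_extensional[OF _ _ \<open>open W\<close>])
    show "finite S" "finite K" using fin finJ by (auto simp: S_def K_def)
    define h0 where "h0 = restrict (\<lambda>s. case s of Inl i \<Rightarrow> x0 i | Inr i \<Rightarrow> 1) S"
    have "xx h0 = x0"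
      using x0 by (auto simp: xx_def h0_def S_def open_cube_def fun_eq_iff PiE_def extensional_def)
    moreover have "h0 (Inl i) = x0 i" if "i \<in> {1..k}" for i using that by (auto simp: h0_def S_def)
    moreover have "h0 (Inr i) = 1" if "i \<in> I \<union> A" for i using that by (auto simp: h0_def S_def)
    ultimately have "h0 \<in> W"
      using \<open>x0 \<in> Q\<close> O'(2) x0 by (auto simp: W_def open_cube_def PiE_def Pi_def)
    then show "W \<inter> (S \<rightarrow>\<^sub>E UNIV) \<noteq> {}" by (auto simp: h0_def)
    show "continuous_on (W \<inter> (S \<rightarrow>\<^sub>E UNIV)) F"
      unfolding F_def
    proof (intro continuous_on_coordinatewise_then_product continuous_intros cont_c)
      fix p :: "nat \<times> 'b"
      show "continuous_on (W \<inter> (S \<rightarrow>\<^sub>E UNIV)) (\<lambda>x. f (xx x) (fst p))"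
        by (rule continuous_on_compose2[OF cont_i cont_xx]) (use WQ in \<open>auto simp: Q_def\<close>)
    qed
  next
    fix h h' assume h: "h \<in> W \<inter> (S \<rightarrow>\<^sub>E UNIV)" and h': "h' \<in> W \<inter> (S \<rightarrow>\<^sub>E UNIV)"
      and eq: "\<And>j. j \<in> K \<Longrightarrow> F h j = F h' j"
    define x y where "x = xx h" and "y = xx h'"
    have xQ: "x \<in> Q" and yQ: "y \<in> Q" using h h' WQ by (auto simp: x_def y_def)
    then have xc: "x \<in> open_cube k" and yc: "y \<in> open_cube k" by (auto simp: Q_def)
    have pos: "h (Inr i) > 0" "h' (Inr i) > 0" if "i \<in> I \<union> A" for i
      using h h' that by (auto simp: W_def)
    \<comment> \<open>The norm of a scaled unit vector recovers the factor, and then the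
      vector.\<close>
    have same: "h (Inr i) = h' (Inr i) \<and> f x i = f y i"
      if "i \<in> I \<union> A" "h (Inr i) *\<^sub>R f x i = h' (Inr i) *\<^sub>R f y i" for i
    proof -
      have "norm (h (Inr i) *\<^sub>R f x i) = norm (h' (Inr i) *\<^sub>R f y i)" using that by simp
      then have "h (Inr i) = h' (Inr i)"
        using unit[OF xc that(1)] unit[OF yc that(1)] pos[OF that(1)] by simp
      then show ?thesis using that pos[OF that(1)] by simp
    qed
    have JA: "h (Inr i) *\<^sub>R f x i = h' (Inr i) *\<^sub>R f y i" if "i \<in> J \<union> A" for i
    proof (rule euclidean_eqI)
      fix b :: 'b assume "b \<in> Basis"
      then show "(h (Inr i) *\<^sub>R f x i) \<bullet> b = (h' (Inr i) *\<^sub>R f y i) \<bullet> b"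
        using eq[of "(i, b)"] that by (auto simp: K_def F_def x_def y_def)
    qed
    have JA': "f x i = f y i" if "i \<in> J \<union> A" for i
      using same[OF _ JA[OF that]] that J(1) by auto
    \<comment> \<open>Both scaled vectors lie in the span of the common vectors indexed by
      \<open>J\<close>, where the pairings with \<open>g\<close> separate points.\<close>
    have IJ: "h (Inr i) *\<^sub>R f x i = h' (Inr i) *\<^sub>R f y i" if "i \<in> I - J" for i
    proof -
      define v where "v = h (Inr i) *\<^sub>R f x i - h' (Inr i) *\<^sub>R f y i"
      have "f y ` J = f x ` J" using JA' by auto
      then have "v \<in> span (f x ` J)"
        using spanQ[OF xQ, of i] spanQ[OF yQ, of i] that
        by (auto simp: v_def intro!: span_diff span_scale)
      moreover have "g j \<bullet> v = 0" if "j \<in> J" for j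
        using eq[of "(i, g j)"] \<open>i \<in> I - J\<close> that
        by (simp add: K_def F_def x_def y_def v_def inner_diff_right inner_commute)
      ultimately have "v = 0" using inj_span[OF xQ] by blast
      then show ?thesis by (simp add: v_def)
    qed
    have all: "h (Inr i) = h' (Inr i) \<and> f x i = f y i" if "i \<in> I \<union> A" for i
      using same[OF that] JA[of i] IJ[of i] that by blast
    then have "f x = f y" using det[OF xc yc] by blast
    then have "x = y" using inj xc yc by (auto simp: inj_on_def)
    show "h = h'"
    proof
      fix s show "h s = h' s"
      proof (cases "s \<in> S")
        case True
        then consider t where "s = Inl t" "t \<in> {1..k}" | t where "s = Inr t" "t \<in> I \<union> A"
          by (auto simp: S_def)
        then show ?thesis
        proof cases
          case 1
          then show ?thesis using fun_cong[OF \<open>x = y\<close>, of t] by (simp add: x_def y_def xx_def)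
        next
          case 2
          then show ?thesis using all by blast
        qed
      next
        case False
        then show ?thesis using h h' by (auto simp: PiE_def extensional_def)
      qed
    qed
  qed
  moreover have "card S = k + card I + card A"
  proof -
    have "card S = card (Inl ` {1..k} :: (nat + nat) set) + card (Inr ` (I \<union> A) :: (nat + nat) set)"
      unfolding S_def using fin by (intro card_Un_disjoint) auto
    also have "\<dots> = k + card (I \<union> A)" by (simp add: card_image)
    finally show ?thesis using fin disj by (simp add: card_Un_disjoint)
  qed
  moreover have "card K \<le> (q + card A) * DIM('b) + (card I - q) * q"
  proof -
    have "card K \<le> card ((J \<union> A) \<times> (Basis :: 'b set)) + card ((I - J) \<times> g ` J)"
      unfolding K_def by (rule card_Un_le)
    also have "\<dots> \<le> (q + card A) * DIM('b) + (card I - q) * q"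
      using card_Un_le[of J A] J(1) finJ card_image_le[OF finJ, of g]
      by (simp add: card_cartesian_product cardJ card_Diff_subset add_mono mult_le_mono)
    finally show ?thesis .
  qed
  moreover have "q \<le> r" using rank[OF x0] by (simp add: q_def)
  moreover have "q \<le> card I" using cardJ card_mono[OF fin(1) J(1)] by simp
  ultimately show ?thesis by (intro exI[of _ q]) auto
qed

section \<open>Realizations of polytopes\<close>

lemma finite_vertices:
  assumes "polytope P" shows "finite (vertices P)"
proof -
  obtain S where "finite S" "P = convex hull S" using assms by (auto simp: polytope_def)
  then show ?thesis
    using extreme_points_of_convex_hull[of S] by (auto simp: vertices_def intro: finite_subset)
qed

lemma singleton_face_of_vertex: "x \<in> vertices P \<Longrightarrow> {x} face_of P"
  by (simp add: vertices_def face_of_singleton)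

lemma vertices_subset: "vertices P \<subseteq> P"
  by (auto simp: vertices_def extreme_point_of_def)

text \<open>A nonempty face is compact and convex, so it has an extreme point, which is also a
  vertex of \<open>P\<close>. This describes the vertices by the order of faces alone.\<close>

lemma minimal_faces_eq_vertices:
  assumes "polytope P"
  shows "{F \<in> face_lattice P. F \<noteq> {} \<and> (\<forall>G\<in>face_lattice P. G \<subseteq> F \<longrightarrow> G = {} \<or> G = F)}
           = (\<lambda>x. {x}) ` vertices P" (is "?L = ?R")
proof
  show "?R \<subseteq> ?L"
    by (auto simp: face_lattice_def singleton_face_of_vertex)
  show "?L \<subseteq> ?R"
  proof
    fix F assume F: "F \<in> ?L"
    then have face: "F face_of P" by (simp add: face_lattice_def)
    then have "compact F" "convex F"
      using face_of_imp_compact[OF polytope_imp_convex polytope_imp_compact] assms face_of_imp_convex by blast+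
    then obtain x where x: "x extreme_point_of F"
      using F extreme_point_exists_convex[of F] by blast
    then have xP: "x \<in> vertices P"
      using face by (simp add: vertices_def extreme_point_of_face)
    moreover have "x \<in> F" using x by (simp add: extreme_point_of_def)
    ultimately have "{x} = F"
      using F singleton_face_of_vertex[of x P] by (auto simp: face_lattice_def)
    then show "F \<in> ?R" using xP by blast
  qed
qed

text \<open>An order isomorphism maps the least face to the least face, hence atoms to
  atoms.\<close>

lemma comb_equivalent_card_vertices:
  assumes P: "polytope P" and Q: "polytope Q" and "comb_equivalent P Q"
  shows "card (vertices P) = card (vertices Q)"
proof -
  obtain \<phi> where bij: "bij_betw \<phi> (face_lattice P) (face_lattice Q)"
    and mono: "\<And>F G. F \<in> face_lattice P \<Longrightarrow> G \<in> face_lattice P \<Longrightarrow> F \<subseteq> G \<longleftrightarrow> \<phi> F \<subseteq> \<phi> G"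
    using assms(3) by (auto simp: comb_equivalent_def lattice_iso_def)
  have empty: "{} \<in> face_lattice P" "{} \<in> face_lattice Q"
    by (auto simp: face_lattice_def)
  have \<phi>0: "\<phi> {} = {}"
  proof -
    obtain F where "F \<in> face_lattice P" "\<phi> F = {}" using bij empty(2) by (metis bij_betw_iff_bijections)
    then show ?thesis using mono[OF empty(1), of F] by auto
  qed
  let ?mP = "{F \<in> face_lattice P. F \<noteq> {} \<and> (\<forall>G\<in>face_lattice P. G \<subseteq> F \<longrightarrow> G = {} \<or> G = F)}"
  let ?mQ = "{F \<in> face_lattice Q. F \<noteq> {} \<and> (\<forall>G\<in>face_lattice Q. G \<subseteq> F \<longrightarrow> G = {} \<or> G = F)}"
  have inj: "inj_on \<phi> (face_lattice P)" and surj: "\<phi> ` face_lattice P = face_lattice Q"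
    using bij by (auto simp: bij_betw_def)
  have ne: "\<phi> F \<noteq> {} \<longleftrightarrow> F \<noteq> {}" if "F \<in> face_lattice P" for F
    using inj_onD[OF inj, of F "{}"] \<phi>0 empty(1) that by auto
  have min: "F \<in> ?mP \<longleftrightarrow> \<phi> F \<in> ?mQ" if F: "F \<in> face_lattice P" for F
  proof -
    have "(\<forall>G\<in>face_lattice Q. G \<subseteq> \<phi> F \<longrightarrow> G = {} \<or> G = \<phi> F)
       \<longleftrightarrow> (\<forall>G\<in>face_lattice P. \<phi> G \<subseteq> \<phi> F \<longrightarrow> \<phi> G = {} \<or> \<phi> G = \<phi> F)"
      unfolding surj[symmetric] by blast
    also have "\<dots> \<longleftrightarrow> (\<forall>G\<in>face_lattice P. G \<subseteq> F \<longrightarrow> G = {} \<or> G = F)"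
      using mono[OF _ F] ne inj_on_eq_iff[OF inj _ F] by auto
    finally have "(\<forall>G\<in>face_lattice Q. G \<subseteq> \<phi> F \<longrightarrow> G = {} \<or> G = \<phi> F)
       \<longleftrightarrow> (\<forall>G\<in>face_lattice P. G \<subseteq> F \<longrightarrow> G = {} \<or> G = F)" .
    moreover have "\<phi> F \<in> face_lattice Q" using F surj by blast
    ultimately show ?thesis unfolding mem_Collect_eq using F ne[OF F] by blast
  qed
  have "\<phi> ` ?mP = ?mQ"
  proof
    show "\<phi> ` ?mP \<subseteq> ?mQ"
    proof (rule image_subsetI)
      fix F assume F: "F \<in> ?mP"
      then have "F \<in> face_lattice P" by simp
      from min[OF this] F show "\<phi> F \<in> ?mQ" by (rule iffD1)
    qed
    show "?mQ \<subseteq> \<phi> ` ?mP"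
    proof
      fix G assume G: "G \<in> ?mQ"
      then have "G \<in> \<phi> ` face_lattice P" unfolding surj by simp
      then obtain F where F: "F \<in> face_lattice P" "G = \<phi> F" by (rule imageE)
      have "F \<in> ?mP" using min[OF F(1)] G unfolding F(2) by (rule iffD2)
      then show "G \<in> \<phi> ` ?mP" unfolding F(2) by (rule imageI)
    qed
  qed
  moreover have "card (\<phi> ` ?mP) = card ?mP"
    by (rule card_image, rule inj_on_subset[OF inj]) auto
  ultimately have "card ?mP = card ?mQ" by simp
  then have "card ((\<lambda>x. {x}) ` vertices P) = card ((\<lambda>x. {x}) ` vertices Q)"
    using minimal_faces_eq_vertices[OF P] minimal_faces_eq_vertices[OF Q] by simp
  then show ?thesis by (simp add: card_image)
qed

text \<open>
  The labelled face lattice, read off from supporting hyperplanes: the vertex sets of the faces of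
  \<open>P\<close> are exactly the sets on which some linear functional, nonpositive on all \<open>v x\<close>, vanishes.
\<close>

definition realizes :: "'a::euclidean_space set \<Rightarrow> ('a \<Rightarrow> 'b::euclidean_space) \<Rightarrow> bool" where
  "realizes P v \<longleftrightarrow>
     (\<forall>x\<in>vertices P. norm (v x) = 1) \<and>
     (\<forall>F. F face_of P \<longrightarrow> (\<exists>a. \<forall>x\<in>vertices P. a \<bullet> v x \<le> 0 \<and> (a \<bullet> v x = 0 \<longleftrightarrow> x \<in> F))) \<and>
     (\<forall>a. (\<forall>x\<in>vertices P. a \<bullet> v x \<le> 0) \<longrightarrow>
        (\<exists>F. F face_of P \<and> (\<forall>x\<in>vertices P. x \<in> F \<longleftrightarrow> a \<bullet> v x = 0)))"

text \<open>A halfspace through the origin that contains the vectors contains their spherical hull,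
  so supporting great hyperspheres and supporting functionals on the vectors are the same thing.
  That a vertex lies in a face is an inclusion of faces, which the lattice isomorphism
  preserves.\<close>

lemma realization_space_realizes:
  assumes lab: "vertex_labelling P p" and V: "V \<in> realization_space P p"
  shows "realizes P (\<lambda>x. V (inv_into {1..card (vertices P)} p x))"
proof -
  define N where "N = card (vertices P)"
  define X where "X = V ` {1..N}"
  define Q where "Q = spherical_hull X"
  define l where "l = inv_into {1..N} p"
  have p: "bij_betw p {1..N} (vertices P)" using lab by (simp add: vertex_labelling_def N_def)
  have l: "l x \<in> {1..N}" "p (l x) = x" if "x \<in> vertices P" for x
    unfolding l_def using p that by (metis bij_betw_def inv_into_into, metis bij_betw_def f_inv_into_f)
  obtain \<phi> where bij: "bij_betw \<phi> (face_lattice P) (spherical_face_lattice Q)"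
    and mono: "\<And>F G. F \<in> face_lattice P \<Longrightarrow> G \<in> face_lattice P \<Longrightarrow> F \<subseteq> G \<longleftrightarrow> \<phi> F \<subseteq> \<phi> G"
    and lab': "\<And>i. i \<in> {1..N} \<Longrightarrow> \<phi> {p i} = {V i}"
    and hemi: "in_open_hemisphere X"
    using V by (auto simp: realization_space_def lattice_iso_def N_def X_def Q_def)
  have VX: "V (l x) \<in> X" if "x \<in> vertices P" for x using l[OF that] by (auto simp: X_def)
  have XQ: "X \<subseteq> Q"
    using hemi hull_subset[of X convex] hull_subset[of "convex hull X" conic]
    by (auto simp: Q_def spherical_hull_def in_open_hemisphere_def)
  have mem: "x \<in> F \<longleftrightarrow> V (l x) \<in> \<phi> F" if "x \<in> vertices P" "F \<in> face_lattice P" for x F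
    using mono[of "{x}" F] that singleton_face_of_vertex[of x P] lab'[of "l x"] l[of x]
    by (auto simp: face_lattice_def)
  have "\<exists>a. \<forall>x\<in>vertices P. a \<bullet> V (l x) \<le> 0 \<and> (a \<bullet> V (l x) = 0 \<longleftrightarrow> x \<in> F)" if "F face_of P" for F
  proof -
    have F: "F \<in> face_lattice P" using that by (simp add: face_lattice_def)
    then have "\<phi> F \<in> spherical_face_lattice Q" using bij by (auto simp: bij_betw_def)
    then obtain a where a: "Q \<subseteq> {x. a \<bullet> x \<le> 0}" "\<phi> F = Q \<inter> {x. a \<bullet> x = 0}"
      by (auto simp: spherical_face_lattice_def)
    show ?thesis
    proof (intro exI ballI conjI)
      fix x assume x: "x \<in> vertices P"
      then have "V (l x) \<in> Q" using VX XQ by blast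
      then show "a \<bullet> V (l x) \<le> 0" "a \<bullet> V (l x) = 0 \<longleftrightarrow> x \<in> F"
        using a mem[OF x F] by auto
    qed
  qed
  moreover have "\<exists>F. F face_of P \<and> (\<forall>x\<in>vertices P. x \<in> F \<longleftrightarrow> a \<bullet> V (l x) = 0)"
    if a: "\<forall>x\<in>vertices P. a \<bullet> V (l x) \<le> 0" for a
  proof -
    have "a \<bullet> y \<le> 0" if "y \<in> X" for y
    proof -
      obtain i where "i \<in> {1..N}" "y = V i" using \<open>y \<in> X\<close> by (auto simp: X_def)
      moreover have "p i \<in> vertices P" "l (p i) = i"
        using p \<open>i \<in> {1..N}\<close> by (auto simp: bij_betw_def l_def)
      ultimately show ?thesis using a by metis
    qed
    then have "convex hull X \<subseteq> {x. a \<bullet> x \<le> 0}"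
      by (intro hull_minimal) (auto simp: convex_halfspace_le)
    then have "conic hull (convex hull X) \<subseteq> {x. a \<bullet> x \<le> 0}"
      by (rule hull_minimal) (auto simp: conic_def mult_nonneg_nonpos)
    then have "Q \<subseteq> {x. a \<bullet> x \<le> 0}" by (auto simp: Q_def spherical_hull_def)
    then have "Q \<inter> {x. a \<bullet> x = 0} \<in> spherical_face_lattice Q"
      unfolding spherical_face_lattice_def by blast
    then have "Q \<inter> {x. a \<bullet> x = 0} \<in> \<phi> ` face_lattice P" using bij by (simp add: bij_betw_def)
    then obtain F where F: "F \<in> face_lattice P" "\<phi> F = Q \<inter> {x. a \<bullet> x = 0}" by force
    have "x \<in> F \<longleftrightarrow> a \<bullet> V (l x) = 0" if "x \<in> vertices P" for x
      using mem[OF that F(1)] F(2) VX[OF that] XQ by auto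
    then show ?thesis using F(1) by (auto simp: face_lattice_def)
  qed
  moreover have "norm (V (l x)) = 1" if "x \<in> vertices P" for x
    using hemi VX[OF that] by (auto simp: in_open_hemisphere_def)
  ultimately show ?thesis
    unfolding realizes_def N_def[symmetric] l_def[symmetric] by blast
qed

section \<open>Linear relations forced by the face lattice\<close>

lemma realizes_face:
  assumes "realizes P v" "F face_of P"
  shows "\<exists>a. (\<forall>x\<in>vertices P. a \<bullet> v x \<le> 0) \<and> (\<forall>x\<in>vertices P. a \<bullet> v x = 0 \<longleftrightarrow> x \<in> F)"
  using assms unfolding realizes_def by blast

lemma realizes_supporting:
  assumes "realizes P v" "\<forall>x\<in>vertices P. a \<bullet> v x \<le> 0"
  shows "\<exists>F. F face_of P \<and> (\<forall>x\<in>vertices P. x \<in> F \<longleftrightarrow> a \<bullet> v x = 0)"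
  using assms unfolding realizes_def by blast

lemma realizes_vertex:
  assumes "realizes P v" "x \<in> vertices P"
  obtains a where "a \<bullet> v x = 0" "\<And>y. y \<in> vertices P \<Longrightarrow> y \<noteq> x \<Longrightarrow> a \<bullet> v y < 0"
proof -
  obtain a where "\<forall>y\<in>vertices P. a \<bullet> v y \<le> 0" "\<forall>y\<in>vertices P. a \<bullet> v y = 0 \<longleftrightarrow> y \<in> {x}"
    using realizes_face[OF assms(1) singleton_face_of_vertex[OF assms(2)]] by blast
  then show ?thesis using that[of a] assms(2) by (auto simp: less_le)
qed

text \<open>The functional that exposes \<open>x\<close> kills its term and is negative at
  \<open>y\<close>, \<open>z\<close> and \<open>w\<close>.\<close>

lemma realizes_sign:
  assumes "realizes P v" and "x \<in> vertices P" "y \<in> vertices P" "z \<in> vertices P" "w \<in> vertices P"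
    and "x \<noteq> y" "x \<noteq> z" "x \<noteq> w"
    and rel: "v w = \<alpha> *\<^sub>R v x + \<beta> *\<^sub>R v y + \<gamma> *\<^sub>R v z"
  shows "\<beta> > 0 \<or> \<gamma> > 0"
proof (rule ccontr)
  assume "\<not> (\<beta> > 0 \<or> \<gamma> > 0)"
  moreover obtain a where a: "a \<bullet> v x = 0" "\<And>y. y \<in> vertices P \<Longrightarrow> y \<noteq> x \<Longrightarrow> a \<bullet> v y < 0"
    using realizes_vertex assms by blast
  ultimately have "0 \<le> \<beta> * (a \<bullet> v y)" "0 \<le> \<gamma> * (a \<bullet> v z)"
    using less_imp_le[OF a(2)[of y]] less_imp_le[OF a(2)[of z]] assms by (auto intro!: mult_nonpos_nonpos)
  moreover have "a \<bullet> v w = \<beta> * (a \<bullet> v y) + \<gamma> * (a \<bullet> v z)"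
    using a(1) by (simp add: rel inner_add_right)
  ultimately show False using a(2)[of w] assms by auto
qed

text \<open>Three extreme rays of a pointed cone cannot lie in a plane.\<close>

lemma realizes_three_independent:
  assumes r: "realizes P v" and xyz: "x \<in> vertices P" "y \<in> vertices P" "z \<in> vertices P"
    and ne: "x \<noteq> y" "x \<noteq> z" "y \<noteq> z"
    and rel: "\<alpha> *\<^sub>R v x + \<beta> *\<^sub>R v y + \<gamma> *\<^sub>R v z = 0"
  shows "\<alpha> = 0" "\<beta> = 0" "\<gamma> = 0"
proof -
  obtain a where a: "a \<bullet> v x = 0" "a \<bullet> v y < 0" "a \<bullet> v z < 0"
    using realizes_vertex[OF r xyz(1)] xyz ne by metis
  obtain b where b: "b \<bullet> v y = 0" "b \<bullet> v x < 0" "b \<bullet> v z < 0"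
    using realizes_vertex[OF r xyz(2)] xyz ne by metis
  obtain c where c: "c \<bullet> v z = 0" "c \<bullet> v x < 0" "c \<bullet> v y < 0"
    using realizes_vertex[OF r xyz(3)] xyz ne by metis
  have eqs: "\<alpha> * (u \<bullet> v x) + \<beta> * (u \<bullet> v y) + \<gamma> * (u \<bullet> v z) = 0" for u
    using arg_cong[OF rel, of "\<lambda>t. u \<bullet> t"] by (simp add: inner_add_right)
  \<comment> \<open>The functional exposing one vertex shows that the other two coefficients vanish
    together or have opposite signs. Three numbers cannot have pairwise opposite signs.\<close>
  have pair: "(s = 0 \<and> t = 0) \<or> (s > 0 \<and> t < 0) \<or> (s < 0 \<and> t > 0)"
    if "s * p + t * q = 0" "p < 0" "q < 0" for s t p q :: real
  proof -
    have "s > 0 \<longleftrightarrow> s * p < 0" "s < 0 \<longleftrightarrow> s * p > 0" "t > 0 \<longleftrightarrow> t * q < 0" "t < 0 \<longleftrightarrow> t * q > 0"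
      using that by (auto simp: mult_less_0_iff zero_less_mult_iff)
    then show ?thesis using that(1) by linarith
  qed
  have "(\<beta> = 0 \<and> \<gamma> = 0) \<or> (\<beta> > 0 \<and> \<gamma> < 0) \<or> (\<beta> < 0 \<and> \<gamma> > 0)"
    using pair[of \<beta> "a \<bullet> v y" \<gamma> "a \<bullet> v z"] eqs[of a] a by simp
  moreover have "(\<alpha> = 0 \<and> \<gamma> = 0) \<or> (\<alpha> > 0 \<and> \<gamma> < 0) \<or> (\<alpha> < 0 \<and> \<gamma> > 0)"
    using pair[of \<alpha> "b \<bullet> v x" \<gamma> "b \<bullet> v z"] eqs[of b] b by simp
  moreover have "(\<alpha> = 0 \<and> \<beta> = 0) \<or> (\<alpha> > 0 \<and> \<beta> < 0) \<or> (\<alpha> < 0 \<and> \<beta> > 0)"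
    using pair[of \<alpha> "c \<bullet> v x" \<beta> "c \<bullet> v y"] eqs[of c] c by simp
  ultimately show "\<alpha> = 0" "\<beta> = 0" "\<gamma> = 0" by linarith+
qed

text \<open>\<open>w\<close> and \<open>z\<close> are opposite corners. The crossing of the
  diagonals in \<open>P\<close> ensures that no face of \<open>P\<close> contains \<open>w\<close>
  and \<open>z\<close> but omits \<open>x\<close>; in this form the geometry of \<open>P\<close>
  passes to all its realizations.\<close>

definition square_face :: "'a::euclidean_space set \<Rightarrow> 'a \<Rightarrow> 'a \<Rightarrow> 'a \<Rightarrow> 'a \<Rightarrow> bool" where
  "square_face P w x y z \<longleftrightarrow>
     distinct [w, x, y, z] \<and>
     (\<exists>F. F face_of P \<and> F \<inter> vertices P = {w, x, y, z}) \<and>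
     open_segment x y \<inter> closed_segment w z \<noteq> {}"

lemma square_face_vertices:
  "square_face P w x y z \<Longrightarrow> {w, x, y, z} \<subseteq> vertices P"
  by (auto simp: square_face_def)

text \<open>For tilting a supporting functional: a large multiple of it absorbs any prescribed
  values off its face.\<close>

lemma exists_dominating_factor:
  fixes s t :: "'i \<Rightarrow> real"
  assumes "finite X" "\<And>x. x \<in> X \<Longrightarrow> s x < 0"
  shows "\<exists>K. \<forall>x\<in>X. K * s x + t x < 0"
proof -
  define K where "K = (\<Sum>x\<in>X. (\<bar>t x\<bar> + 1) / (- s x))"
  have "K * s x + t x < 0" if "x \<in> X" for x
  proof -
    have "(\<bar>t x\<bar> + 1) / (- s x) \<le> K"
      unfolding K_def using assms that by (intro member_le_sum) (auto simp: divide_nonneg_neg less_imp_le)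
    then have "\<bar>t x\<bar> + 1 \<le> K * (- s x)" using assms(2)[OF that] pos_divide_le_eq[of "- s x"] by (simp del: divide_minus_right)
    then show ?thesis by simp
  qed
  then show ?thesis by blast
qed

text \<open>
  If the four vectors were linearly independent, the cone over the square would be simplicial
  and its diagonal would be a face.
\<close>

lemma realizes_square_dependent:
  assumes r: "realizes P v" and "polytope P" and sq: "square_face P w x y z"
  obtains \<alpha> \<beta> \<gamma> where "v w = \<alpha> *\<^sub>R v x + \<beta> *\<^sub>R v y + \<gamma> *\<^sub>R v z"
proof -
  obtain F where dist: "distinct [w, x, y, z]" and F: "F face_of P" "F \<inter> vertices P = {w, x, y, z}"
    and cross: "open_segment x y \<inter> closed_segment w z \<noteq> {}"
    using sq by (auto simp: square_face_def)
  have vert: "w \<in> vertices P" "x \<in> vertices P" "y \<in> vertices P" "z \<in> vertices P"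
    using square_face_vertices[OF sq] by auto
  have "v w \<in> span {v x, v y, v z}"
  proof (rule ccontr)
    assume notin: "v w \<notin> span {v x, v y, v z}"
    note three = realizes_three_independent[OF r vert(2,3,4)]
    have dxyz: "x \<noteq> y" "x \<noteq> z" "y \<noteq> z" using dist by auto
    have inj3: "v x \<noteq> v y" "v x \<noteq> v z" "v y \<noteq> v z"
      using three(1)[OF dxyz, of 1 "-1" 0] three(1)[OF dxyz, of 1 0 "-1"] three(2)[OF dxyz, of 0 1 "-1"] by auto
    have "independent {v x, v y, v z}"
    proof (rule independent_if_scalars_zero)
      fix f t assume s: "(\<Sum>t\<in>{v x, v y, v z}. f t *\<^sub>R t) = 0" and t: "t \<in> {v x, v y, v z}"
      have "f (v x) *\<^sub>R v x + f (v y) *\<^sub>R v y + f (v z) *\<^sub>R v z = 0"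
        using s inj3 by (simp add: add.assoc)
      then show "f t = 0" using three[OF dxyz] t by blast
    qed auto
    then have indep: "independent (v ` {w, x, y, z})"
      using notin by (simp add: independent_insert)
    have "v w \<noteq> v x" "v w \<noteq> v y" "v w \<noteq> v z"
      using notin span_base[of _ "{v x, v y, v z}"] by auto
    then have inj: "inj_on v {w, x, y, z}"
      using inj3 by (simp add: inj_on_def eq_commute)
    obtain g where g: "\<And>i j. i \<in> {w, x, y, z} \<Longrightarrow> j \<in> {w, x, y, z} \<Longrightarrow> g i \<bullet> v j = (if i = j then 1 else 0)"
      using dual_vectors_exist[OF indep inj] by blast
    \<comment> \<open>\<open>b\<close> vanishes on the diagonal \<open>w\<close>, \<open>z\<close>
      and is negative at \<open>x\<close> and \<open>y\<close>. Adding a large multiple of the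
      functional \<open>a\<close> of the square makes it nonpositive at the remaining vertices
      too.\<close>
    define b where "b = - g x - g y"
    have b: "b \<bullet> v w = 0" "b \<bullet> v z = 0" "b \<bullet> v x = -1" "b \<bullet> v y = -1"
      using g dist by (auto simp: b_def inner_diff_left)
    obtain a where a: "\<forall>t\<in>vertices P. a \<bullet> v t \<le> 0" "\<forall>t\<in>vertices P. a \<bullet> v t = 0 \<longleftrightarrow> t \<in> F"
      using realizes_face[OF r F(1)] by blast
    obtain K where K: "\<forall>t\<in>vertices P - F. K * (a \<bullet> v t) + b \<bullet> v t < 0"
      using exists_dominating_factor[of "vertices P - F" "\<lambda>t. a \<bullet> v t" "\<lambda>t. b \<bullet> v t"]
        finite_vertices[OF \<open>polytope P\<close>] a by (auto simp: less_le)
    define c where "c = K *\<^sub>R a + b"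
    have cF: "c \<bullet> v t = b \<bullet> v t" if "t \<in> {w, x, y, z}" for t
      using bspec[OF a(2), of t] that F(2) by (auto simp: c_def inner_add_left)
    have "c \<bullet> v t \<le> 0" if "t \<in> vertices P" for t
    proof (cases "t \<in> F")
      case True
      then have "t \<in> {w, x, y, z}" using F(2) that by blast
      then show ?thesis using cF[of t] b by auto
    next
      case False
      then have "K * (a \<bullet> v t) + b \<bullet> v t < 0" using K that by blast
      then show ?thesis by (simp add: c_def inner_add_left)
    qed
    then obtain G where G: "G face_of P" "\<forall>t\<in>vertices P. t \<in> G \<longleftrightarrow> c \<bullet> v t = 0"
      using realizes_supporting[OF r, of c] by blast
    \<comment> \<open>The crossing point of the diagonals lies in \<open>G\<close> and inside the
      open segment from \<open>x\<close> to \<open>y\<close>, so the face \<open>G\<close> would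
      have to contain \<open>x\<close>.\<close>
    have "w \<in> G" "z \<in> G" "x \<notin> G" using G(2) vert cF b by auto
    moreover obtain u where u: "u \<in> open_segment x y" "u \<in> closed_segment w z" using cross by blast
    ultimately have "u \<in> G"
      using face_of_imp_convex[OF G(1)] closed_segment_subset by blast
    then have "x \<in> G"
      using face_ofD[OF G(1) u(1)] vert vertices_subset[of P] by blast
    then show False using \<open>x \<notin> G\<close> by blast
  qed
  then obtain \<alpha> \<beta> where "v w - \<alpha> *\<^sub>R v x - \<beta> *\<^sub>R v y \<in> span {v z}"
    by (auto simp: span_breakdown_eq[of _ "v x"] span_breakdown_eq[of _ "v y"])
  then obtain \<gamma> where "v w - \<alpha> *\<^sub>R v x - \<beta> *\<^sub>R v y = \<gamma> *\<^sub>R v z"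
    by (auto simp: span_singleton)
  then have "v w = \<alpha> *\<^sub>R v x + \<beta> *\<^sub>R v y + \<gamma> *\<^sub>R v z"
    by (simp add: algebra_simps)
  then show ?thesis using that by blast
qed

text \<open>By the hypotheses \<open>ne\<close>, a functional that exposes one square does not
  vanish at the third neighbour of \<open>w\<close>. Comparing the three squares therefore leaves
  \<open>v' w\<close> a multiple of \<open>v w\<close>. Unit length leaves the factors 1 and -1, and
  the signs in a square relation exclude -1.\<close>

lemma realizes_squares_determine:
  assumes r: "realizes P v" and r': "realizes P v'" and P: "polytope P"
    and s12: "square_face P w x1 x2 y12" and s13: "square_face P w x1 x3 y13" and s23: "square_face P w x2 x3 y23"
    and ne: "x3 \<notin> {w, x1, x2, y12}" "x2 \<notin> {w, x1, x3, y13}" "x1 \<notin> {w, x2, x3, y23}"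
    and agree: "\<And>t. t \<in> {x1, x2, x3, y12, y13, y23} \<Longrightarrow> v' t = v t"
  shows "v' w = v w"
proof -
  have vert: "w \<in> vertices P" "x1 \<in> vertices P" "x2 \<in> vertices P" "x3 \<in> vertices P"
     "y12 \<in> vertices P" "y13 \<in> vertices P" "y23 \<in> vertices P"
    using s12 s13 s23 by (auto dest!: square_face_vertices)
  \<comment> \<open>The opposite corner is traded for \<open>w\<close>, so that the functionals
    exposing the squares act on vectors at \<open>w\<close> and its neighbours.\<close>
  have in_span: "\<exists>a b c. v' w = a *\<^sub>R v w + b *\<^sub>R v x + c *\<^sub>R v y"
    if sq: "square_face P w x y z" and ag: "v' x = v x" "v' y = v y" "v' z = v z" for x y z
  proof -
    obtain \<alpha> \<beta> \<gamma> where rel: "v w = \<alpha> *\<^sub>R v x + \<beta> *\<^sub>R v y + \<gamma> *\<^sub>R v z"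
      using realizes_square_dependent[OF r P sq] by blast
    obtain \<alpha>' \<beta>' \<gamma>' where rel': "v' w = \<alpha>' *\<^sub>R v x + \<beta>' *\<^sub>R v y + \<gamma>' *\<^sub>R v z"
      using realizes_square_dependent[OF r' P sq] ag by metis
    have d: "x \<in> vertices P" "y \<in> vertices P" "w \<noteq> x" "w \<noteq> y" "x \<noteq> y"
      using sq square_face_vertices[OF sq] by (auto simp: square_face_def)
    have "\<gamma> \<noteq> 0"
    proof
      assume "\<gamma> = 0"
      then have "1 *\<^sub>R v w + (- \<alpha>) *\<^sub>R v x + (- \<beta>) *\<^sub>R v y = 0" using rel by simp
      then have "(1::real) = 0" by (rule realizes_three_independent(1)[OF r vert(1) d(1,2,3,4,5)])
      then show False by simp
    qed
    then have "v z = (1 / \<gamma>) *\<^sub>R v w + (- \<alpha> / \<gamma>) *\<^sub>R v x + (- \<beta> / \<gamma>) *\<^sub>R v y"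
      using rel by (simp add: algebra_simps flip: scaleR_scaleR[of "1 / \<gamma>"])
    then have "v' w = (\<gamma>' * (1 / \<gamma>)) *\<^sub>R v w + (\<alpha>' + \<gamma>' * (- \<alpha> / \<gamma>)) *\<^sub>R v x + (\<beta>' + \<gamma>' * (- \<beta> / \<gamma>)) *\<^sub>R v y"
      by (subst rel', simp only: scaleR_add_right scaleR_add_left scaleR_scaleR add_ac)
    then show ?thesis by blast
  qed
  have expose: "\<exists>a. a \<bullet> v w = 0 \<and> a \<bullet> v x = 0 \<and> a \<bullet> v y = 0 \<and> a \<bullet> v u \<noteq> 0"
    if sq: "square_face P w x y z" and u: "u \<in> vertices P" "u \<notin> {w, x, y, z}" for x y z u
  proof -
    obtain F where F: "F face_of P" "F \<inter> vertices P = {w, x, y, z}"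
      using sq by (auto simp: square_face_def)
    obtain a where "\<forall>t\<in>vertices P. a \<bullet> v t = 0 \<longleftrightarrow> t \<in> F"
      using realizes_face[OF r F(1)] by blast
    moreover have "w \<in> F" "x \<in> F" "y \<in> F" "u \<notin> F" using F(2) u by auto
    ultimately show ?thesis using square_face_vertices[OF sq] u(1) by (intro exI[of _ a]) auto
  qed
  obtain e12 where e12: "e12 \<bullet> v w = 0" "e12 \<bullet> v x1 = 0" "e12 \<bullet> v x2 = 0" "e12 \<bullet> v x3 \<noteq> 0"
    using expose[OF s12 vert(4) ne(1)] by blast
  obtain e13 where e13: "e13 \<bullet> v w = 0" "e13 \<bullet> v x1 = 0" "e13 \<bullet> v x3 = 0" "e13 \<bullet> v x2 \<noteq> 0"
    using expose[OF s13 vert(3) ne(2)] by blast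
  obtain e23 where e23: "e23 \<bullet> v w = 0" "e23 \<bullet> v x2 = 0" "e23 \<bullet> v x3 = 0" "e23 \<bullet> v x1 \<noteq> 0"
    using expose[OF s23 vert(2) ne(3)] by blast
  obtain a0 a1 a2 where a: "v' w = a0 *\<^sub>R v w + a1 *\<^sub>R v x1 + a2 *\<^sub>R v x2"
    using in_span[OF s12] agree by blast
  obtain b0 b1 b3 where b: "v' w = b0 *\<^sub>R v w + b1 *\<^sub>R v x1 + b3 *\<^sub>R v x3"
    using in_span[OF s13] agree by blast
  obtain c0 c2 c3 where c: "v' w = c0 *\<^sub>R v w + c2 *\<^sub>R v x2 + c3 *\<^sub>R v x3"
    using in_span[OF s23] agree by blast
  have "a1 = 0"
  proof -
    have "e23 \<bullet> v' w = 0" using e23 by (simp add: c inner_add_right)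
    then show ?thesis using e23 by (simp add: a inner_add_right)
  qed
  moreover have "a2 = 0"
  proof -
    have "e13 \<bullet> v' w = 0" using e13 by (simp add: b inner_add_right)
    then show ?thesis using e13 by (simp add: a inner_add_right)
  qed
  ultimately have a': "v' w = a0 *\<^sub>R v w" using a by simp
  have "norm (v' w) = 1" "norm (v w) = 1" using r r' vert(1) by (auto simp: realizes_def)
  then have "\<bar>a0\<bar> = 1" using a' by simp
  moreover have "a0 \<noteq> -1"
  proof
    assume "a0 = -1"
    then have neg: "v' w = - v w" using a' by simp
    obtain \<alpha> \<beta> \<gamma> where rel: "v w = \<alpha> *\<^sub>R v x1 + \<beta> *\<^sub>R v x2 + \<gamma> *\<^sub>R v y12"
      using realizes_square_dependent[OF r P s12] by blast
    then have rel': "v' w = (- \<alpha>) *\<^sub>R v' x1 + (- \<beta>) *\<^sub>R v' x2 + (- \<gamma>) *\<^sub>R v' y12"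
      using agree neg by simp
    have d: "w \<noteq> x1" "w \<noteq> x2" "w \<noteq> y12" "x1 \<noteq> x2" "x1 \<noteq> y12" "x2 \<noteq> y12"
      using s12 by (auto simp: square_face_def)
    \<comment> \<open>Exposing the other three corners in turn leaves at most one nonpositive
      coefficient. Negating all three cannot preserve this.\<close>
    have signs: "(b > 0 \<or> c > 0) \<and> (a > 0 \<or> c > 0) \<and> (a > 0 \<or> b > 0)"
      if "realizes P t" "t w = a *\<^sub>R t x1 + b *\<^sub>R t x2 + c *\<^sub>R t y12" for t :: "'a \<Rightarrow> 'b" and a b c
    proof -
      have "b > 0 \<or> c > 0"
        by (rule realizes_sign[OF that(1) vert(2,3,5,1) _ _ _ that(2)]) (use d in auto)
      moreover have "a > 0 \<or> c > 0"
        by (rule realizes_sign[OF that(1) vert(3,2,5,1), where \<alpha> = b]) (use d that(2) in auto)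
      moreover have "a > 0 \<or> b > 0"
        by (rule realizes_sign[OF that(1) vert(5,2,3,1), where \<alpha> = c]) (use d that(2) in auto)
      ultimately show ?thesis by blast
    qed
    show False using signs[OF r rel] signs[OF r' rel'] by linarith
  qed
  ultimately have "a0 = 1" by linarith
  then show ?thesis using a' by simp
qed

text \<open>The functional belonging to the face opposite \<open>a\<close> vanishes at every vertex
  except \<open>a\<close>. For \<open>a\<close> in \<open>A\<close> these functionals are
  independent, and all of them are orthogonal to the vectors of \<open>B\<close>.\<close>

lemma realizes_base_rank:
  fixes v :: "'a::euclidean_space \<Rightarrow> 'b::euclidean_space"
  assumes r: "realizes P v" and A: "finite A" "A \<subseteq> vertices P" and B: "B \<subseteq> vertices P" "A \<inter> B = {}"
    and faces: "\<And>a. a \<in> A \<Longrightarrow> \<exists>F. F face_of P \<and> F \<inter> vertices P = vertices P - {a}"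
  shows "dim (v ` B) + card A \<le> DIM('b)"
proof -
  have "\<exists>h. \<forall>x\<in>vertices P. h \<bullet> v x = 0 \<longleftrightarrow> x \<noteq> a" if a: "a \<in> A" for a
  proof -
    obtain F where F: "F face_of P" "F \<inter> vertices P = vertices P - {a}" using faces[OF a] by blast
    obtain h where "\<forall>x\<in>vertices P. h \<bullet> v x = 0 \<longleftrightarrow> x \<in> F"
      using realizes_face[OF r F(1)] by blast
    then show ?thesis using F(2) by blast
  qed
  then obtain h where h: "\<And>a x. a \<in> A \<Longrightarrow> x \<in> vertices P \<Longrightarrow> h a \<bullet> v x = 0 \<longleftrightarrow> x \<noteq> a"
    using bchoice[of A "\<lambda>a h. \<forall>x\<in>vertices P. h \<bullet> v x = 0 \<longleftrightarrow> x \<noteq> a"] by blast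
  have inj: "inj_on h A" using h A(2) by (metis inj_onI subsetD)
  have "independent (h ` A)"
  proof (rule independent_if_scalars_zero)
    show "finite (h ` A)" using A by simp
    fix u w assume u: "(\<Sum>w\<in>h ` A. u w *\<^sub>R w) = 0" and "w \<in> h ` A"
    then obtain a where a: "a \<in> A" "w = h a" by blast
    have "0 = (\<Sum>b\<in>A. u (h b) *\<^sub>R h b) \<bullet> v a" using u inj by (simp add: sum.reindex)
    also have "\<dots> = (\<Sum>b\<in>A. u (h b) * (h b \<bullet> v a))" by (simp add: inner_sum_left)
    also have "\<dots> = (\<Sum>b\<in>A. if b = a then u (h a) * (h a \<bullet> v a) else 0)"
      using h a A(2) by (intro sum.cong) auto
    also have "\<dots> = u (h a) * (h a \<bullet> v a)" using a A(1) by simp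
    finally show "u w = 0" using h a A(2) by auto
  qed
  then have "dim (h ` A) = card A" using inj by (simp add: dim_eq_card_independent card_image)
  moreover have "v ` B \<subseteq> {y. \<forall>x\<in>span (h ` A). orthogonal x y}"
  proof clarify
    fix b x assume b: "b \<in> B" and x: "x \<in> span (h ` A)"
    have "subspace {x. orthogonal x (v b)}"
      by (auto simp: subspace_def orthogonal_def inner_add_left)
    moreover have "h ` A \<subseteq> {x. orthogonal x (v b)}"
      using h b B by (auto simp: orthogonal_def)
    ultimately show "orthogonal x (v b)" using x span_minimal by blast
  qed
  then have "dim (v ` B) \<le> dim {y. \<forall>x\<in>span (h ` A). orthogonal x y}" by (rule dim_subset)
  moreover have "dim {y. \<forall>x\<in>span (h ` A). orthogonal x y} + dim (span (h ` A)) = DIM('b)"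
    using dim_subspace_orthogonal_to_vectors[of "span (h ` A)" UNIV] by simp
  ultimately show ?thesis by (simp add: dim_span)
qed

section \<open>A cubic tiling wrapped around a torus\<close>

text \<open>
  The point of layer \<open>j\<close>, sheet \<open>i\<close> and phase \<open>m\<close> has homogeneous coordinates
  \<open>(cone_point j i m, layer_a j)\<close>; sheets count modulo 4 and phases modulo 6, and only the triples with
  \<open>i + j + m\<close> even occur. A step in the three directions of the tiling leads to
  \<open>(j + 1, i + 1, m)\<close>, \<open>(j + 1, i, m + 1)\<close> and \<open>(j + 1, i, m - 1)\<close>.
  Planarity of the squares forces the sequences \<open>layer_a j / 3 ^ j\<close> and \<open>layer_b j / 3 ^ j\<close> to satisfy
  one recurrence \<open>x (j + 2) = 2 c x (j + 1) + (1 - c) x j\<close>; here \<open>c = 8 / 3\<close>, with roots \<open>5\<close> and \<open>1 / 3\<close>.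
  On each of its two sheets the functional supporting a cube solves the same recurrence
  with values proportional to \<open>-1, -1 / 2, -1\<close> on three consecutive layers, which yields
  \<open>cube_normal\<close> and \<open>cube_offset\<close>.
\<close>

definition layer_a :: "nat \<Rightarrow> real" where "layer_a j = 15 ^ j + 2"
definition layer_b :: "nat \<Rightarrow> real" where "layer_b j = 3 - 2 * 15 ^ j"

definition quarter_turn :: "nat \<Rightarrow> real \<times> real \<Rightarrow> real \<times> real" where
  "quarter_turn i p =
     (if i mod 4 = 0 then p
      else if i mod 4 = 1 then (- snd p, fst p)
      else if i mod 4 = 2 then - p
      else (snd p, - fst p))"

definition hexagon :: "nat \<Rightarrow> real \<times> real" where
  "hexagon m =
     (if m mod 6 = 0 then (1, 0) else if m mod 6 = 1 then (0, 1) else if m mod 6 = 2 then (-1, 1)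
      else if m mod 6 = 3 then (-1, 0) else if m mod 6 = 4 then (0, -1) else (1, -1))"

text \<open>
  The hexagon is regular for the quadratic form \<open>x\<^sup>2 + x y + y\<^sup>2\<close>, whose (doubled) Gram matrix
  defines \<open>hexagon_normal\<close>; accordingly \<open>hexagon_cos d\<close> is twice the cosine of \<open>d\<close> sixths of a turn.
\<close>

definition hexagon_normal :: "nat \<Rightarrow> real \<times> real" where
  "hexagon_normal m = (2 * fst (hexagon m) + snd (hexagon m), fst (hexagon m) + 2 * snd (hexagon m))"

definition hexagon_cos :: "nat \<Rightarrow> real" where
  "hexagon_cos d = (if d mod 6 = 0 then 2 else if d mod 6 = 1 \<or> d mod 6 = 5 then 1
     else if d mod 6 = 3 then -2 else -1)"

definition cone_point :: "nat \<Rightarrow> nat \<Rightarrow> nat \<Rightarrow> (real \<times> real) \<times> (real \<times> real)" where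
  "cone_point j i m = (quarter_turn i (layer_a j, layer_b j), 3 ^ j *\<^sub>R hexagon m)"

definition cube_normal :: "nat \<Rightarrow> nat \<Rightarrow> nat \<Rightarrow> (real \<times> real) \<times> (real \<times> real)" where
  "cube_normal k i m =
     (quarter_turn i (405 * 15 ^ k - 2, 10 - 135 * 15 ^ k), (490 * 5 ^ k) *\<^sub>R hexagon_normal m)"

definition cube_offset :: "nat \<Rightarrow> real" where
  "cube_offset k = 13 + 675 * 15 ^ k"

section \<open>Reduction to differences of sheets and phases\<close>

lemma mod_4_cases: "(i::nat) mod 4 = 0 \<or> i mod 4 = 1 \<or> i mod 4 = 2 \<or> i mod 4 = 3"
  by linarith

lemma mod_6_cases:
  "(m::nat) mod 6 = 0 \<or> m mod 6 = 1 \<or> m mod 6 = 2 \<or> m mod 6 = 3 \<or> m mod 6 = 4 \<or> m mod 6 = 5"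
  by linarith

lemma mod_add_mult_right_eq: "((x::nat) + c * y) mod n = (x mod n + c * (y mod n)) mod n"
proof -
  have "(x + c * y) mod n = (x mod n + (c * y) mod n) mod n" by (rule mod_add_eq[symmetric])
  also have "(c * y) mod n = (c * (y mod n)) mod n" by (rule mod_mult_right_eq[symmetric])
  also have "(x mod n + (c * (y mod n)) mod n) mod n = (x mod n + c * (y mod n)) mod n"
    by (rule mod_add_right_eq)
  finally show ?thesis .
qed

text \<open>Quarter turns are orthogonal, so only the difference of turns matters;
  \<open>3 * i\<close> stands for \<open>- i\<close> modulo 4.\<close>

lemma quarter_turn_inner:
  "quarter_turn i p \<bullet> quarter_turn i' q = p \<bullet> quarter_turn (i' + 3 * i) q"
proof -
  note e = mod_add_mult_right_eq[of i' 3 i 4]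
  show ?thesis
    using mod_4_cases[of i] mod_4_cases[of i']
    by (elim disjE) (simp_all add: quarter_turn_def e inner_prod_def)
qed

lemma hexagon_inner: "hexagon_normal m \<bullet> hexagon m' = hexagon_cos (m' + 5 * m)"
proof -
  note e = mod_add_mult_right_eq[of m' 5 m 6]
  show ?thesis
    using mod_6_cases[of m] mod_6_cases[of m']
    by (elim disjE) (simp_all add: hexagon_normal_def hexagon_cos_def hexagon_def e inner_prod_def)
qed

lemma hexagon_cong: "m mod 6 = m' mod 6 \<Longrightarrow> hexagon m = hexagon m'"
  by (simp add: hexagon_def)

lemma quarter_turn_cong: "i mod 4 = i' mod 4 \<Longrightarrow> quarter_turn i = quarter_turn i'"
  by (simp add: quarter_turn_def fun_eq_iff)

lemma cone_point_cong:
  "i mod 4 = i' mod 4 \<Longrightarrow> m mod 6 = m' mod 6 \<Longrightarrow> cone_point j i m = cone_point j i' m'"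
  by (simp add: cone_point_def hexagon_cong[of m m'] quarter_turn_cong[of i i'])

text \<open>
  Membership in the cube with bottom vertex \<open>(k, i, m)\<close> of a vertex \<open>(j, i', m')\<close>, in terms of the
  differences \<open>e\<close> of the sheets and \<open>d\<close> of the phases. To stay within the natural numbers, the
  differences are represented by \<open>i' + 3 * i\<close> modulo 4 and \<open>m' + 5 * m\<close> modulo 6.
\<close>

definition cube_slice :: "nat \<Rightarrow> nat \<Rightarrow> nat \<Rightarrow> bool" where
  "cube_slice k d j \<longleftrightarrow> d mod 6 = 0 \<and> (j = k \<or> j = k + 2) \<or> (d mod 6 = 1 \<or> d mod 6 = 5) \<and> j = k + 1"

definition in_cube :: "nat \<Rightarrow> nat \<Rightarrow> nat \<Rightarrow> nat \<Rightarrow> bool" where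
  "in_cube k e d j \<longleftrightarrow> e mod 4 = 0 \<and> cube_slice k d j \<or> e mod 4 = 1 \<and> cube_slice (k + 1) d j"

section \<open>Support inequalities for the cubes\<close>

lemma power_15: "(15::real) ^ n = 3 ^ n * 5 ^ n"
  by (simp flip: power_mult_distrib)

text \<open>Parity excludes \<open>t = 2\<close> with \<open>l = 1\<close>, where the inequality
  fails. The equalities are 28 = 1 + 27, 42 = 15 + 27 and 252 = 225 + 27; from \<open>l = 3\<close>
  on, \<open>15 ^ l\<close> is at least \<open>125 * 3 ^ l\<close> and dominates.\<close>

lemma layer_inequality_above:
  fixes t :: real
  assumes "t = 2 \<and> even l \<or> t = 1 \<and> odd l"
  shows "14 * 3 ^ l * t \<le> 15 ^ l + 27"
    and "14 * 3 ^ l * t = 15 ^ l + 27 \<longleftrightarrow> t = 2 \<and> (l = 0 \<or> l = 2) \<or> t = 1 \<and> l = 1"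
proof -
  have "14 * 3 ^ l * t \<le> 15 ^ l + 27 \<and>
    (14 * 3 ^ l * t = 15 ^ l + 27 \<longleftrightarrow> t = 2 \<and> (l = 0 \<or> l = 2) \<or> t = 1 \<and> l = 1)"
  proof (cases "l \<ge> 3")
    case True
    have "(125::real) \<le> 5 ^ l" using power_increasing[OF True, of "5::real"] by simp
    then have "3 ^ l * 125 \<le> 3 ^ l * (5::real) ^ l" by simp
    moreover have "14 * 3 ^ l * t \<le> 28 * 3 ^ l" using assms by auto
    moreover have "(0::real) < 3 ^ l" by simp
    ultimately have "14 * 3 ^ l * t < 15 ^ l + 27" unfolding power_15 by linarith
    then show ?thesis using True by auto
  next
    case False
    then have "l = 0 \<or> l = 1 \<or> l = 2" by auto
    then show ?thesis using assms by auto
  qed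
  then show "14 * 3 ^ l * t \<le> 15 ^ l + 27"
    and "14 * 3 ^ l * t = 15 ^ l + 27 \<longleftrightarrow> t = 2 \<and> (l = 0 \<or> l = 2) \<or> t = 1 \<and> l = 1" by blast+
qed

text \<open>For \<open>k <= j\<close>, dividing by \<open>15 ^ k\<close> reduces to the previous
  lemma with \<open>l = j - k\<close>. For \<open>j < k\<close>, dividing by \<open>15 ^ j\<close>
  leaves a strict inequality, as it is for negative \<open>t\<close>.\<close>

lemma layer_inequality:
  fixes t :: real
  assumes t: "t = 2 \<and> even (j + k) \<or> t = 1 \<and> odd (j + k) \<or> t < 0"
  shows "14 * 5 ^ k * 3 ^ j * t \<le> 15 ^ j + 27 * 15 ^ k"
    and "14 * 5 ^ k * 3 ^ j * t = 15 ^ j + 27 * 15 ^ k \<longleftrightarrow>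
           t = 2 \<and> (j = k \<or> j = k + 2) \<or> t = 1 \<and> j = k + 1"
proof -
  have "14 * 5 ^ k * 3 ^ j * t \<le> 15 ^ j + 27 * 15 ^ k \<and>
    (14 * 5 ^ k * 3 ^ j * t = 15 ^ j + 27 * 15 ^ k \<longleftrightarrow>
           t = 2 \<and> (j = k \<or> j = k + 2) \<or> t = 1 \<and> j = k + 1)"
  proof (cases "t < 0")
    case True
    then have "14 * 5 ^ k * 3 ^ j * t < 0" by (simp add: mult_pos_neg)
    moreover have "(0::real) < 15 ^ j + 27 * 15 ^ k" by (simp add: add_pos_pos)
    ultimately have "14 * 5 ^ k * 3 ^ j * t < 15 ^ j + 27 * 15 ^ k" by linarith
    moreover have "t \<noteq> 2" "t \<noteq> 1" using True by auto
    ultimately show ?thesis by (metis less_irrefl less_imp_le)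
  next
    case t0: False
    show ?thesis
    proof (cases "k \<le> j")
      case True
      then obtain l where l: "j = k + l" by (metis le_Suc_ex)
      have tl: "t = 2 \<and> even l \<or> t = 1 \<and> odd l" using t t0 by (auto simp: l)
      have 1: "14 * 5 ^ k * 3 ^ j * t = 15 ^ k * (14 * 3 ^ l * t)"
        by (simp add: l power_add power_15)
      have 2: "(15::real) ^ j + 27 * 15 ^ k = 15 ^ k * (15 ^ l + 27)"
        by (simp add: l power_add algebra_simps)
      show ?thesis
        unfolding 1 2 using layer_inequality_above[OF tl] by (auto simp: l)
    next
      case False
      then obtain l where l: "k = j + l" "l \<ge> 1" by (metis le_Suc_ex nat_le_linear add_0_right le_refl not_less_eq_eq less_one linorder_not_le)
      have "(3::real) \<le> 3 ^ l" using power_increasing[OF l(2), of "3::real"] by simp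
      then have "3 * 5 ^ l \<le> (15::real) ^ l" by (simp add: power_15)
      moreover have "14 * 5 ^ l * t \<le> 28 * 5 ^ l" using t t0 by auto
      moreover have "(0::real) < 5 ^ l" by simp
      ultimately have "14 * 5 ^ l * t < 1 + 27 * 15 ^ l" by linarith
      then have "15 ^ j * (14 * 5 ^ l * t) < 15 ^ j * (1 + 27 * 15 ^ l)" by simp
      moreover have "14 * 5 ^ k * 3 ^ j * t = 15 ^ j * (14 * 5 ^ l * t)"
        by (simp add: l power_add power_15)
      moreover have "(15::real) ^ j + 27 * 15 ^ k = 15 ^ j * (1 + 27 * 15 ^ l)"
        by (simp add: l power_add algebra_simps)
      ultimately have "14 * 5 ^ k * 3 ^ j * t < 15 ^ j + 27 * 15 ^ k" by (simp only:)
      moreover have "j \<noteq> k" "j \<noteq> k + 2" "j \<noteq> k + 1" using False by auto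
      ultimately show ?thesis by (metis less_irrefl less_imp_le)
    qed
  qed
  then show "14 * 5 ^ k * 3 ^ j * t \<le> 15 ^ j + 27 * 15 ^ k"
    and "14 * 5 ^ k * 3 ^ j * t = 15 ^ j + 27 * 15 ^ k \<longleftrightarrow>
           t = 2 \<and> (j = k \<or> j = k + 2) \<or> t = 1 \<and> j = k + 1" by blast+
qed

lemma hexagon_cos_parity:
  assumes "even (d + s)"
  shows "hexagon_cos d = 2 \<and> even s \<or> hexagon_cos d = 1 \<and> odd s \<or> hexagon_cos d < 0"
proof -
  have "even d \<longleftrightarrow> even (d mod 6)" by presburger
  then show ?thesis
    using mod_6_cases[of d] assms by (elim disjE) (auto simp: hexagon_cos_def)
qed

lemma cube_slice_iff:
  "cube_slice k d j \<longleftrightarrow> hexagon_cos d = 2 \<and> (j = k \<or> j = k + 2) \<or> hexagon_cos d = 1 \<and> j = k + 1"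
  by (auto simp: cube_slice_def hexagon_cos_def)

lemma cube_slice_support:
  assumes "even (d + j + k)"
  shows "14 * 5 ^ k * 3 ^ j * hexagon_cos d \<le> 15 ^ j + 27 * 15 ^ k"
    and "14 * 5 ^ k * 3 ^ j * hexagon_cos d = 15 ^ j + 27 * 15 ^ k \<longleftrightarrow> cube_slice k d j"
proof -
  have t: "hexagon_cos d = 2 \<and> even (j + k) \<or> hexagon_cos d = 1 \<and> odd (j + k) \<or> hexagon_cos d < 0"
    using hexagon_cos_parity[of d "j + k"] assms by (simp add: add.assoc)
  show "14 * 5 ^ k * 3 ^ j * hexagon_cos d \<le> 15 ^ j + 27 * 15 ^ k"
    using layer_inequality(1)[OF t] .
  show "14 * 5 ^ k * 3 ^ j * hexagon_cos d = 15 ^ j + 27 * 15 ^ k \<longleftrightarrow> cube_slice k d j"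
    using layer_inequality(2)[OF t] by (simp add: cube_slice_iff)
qed

lemma hexagon_cos_le: "hexagon_cos d \<le> 2"
  by (simp add: hexagon_cos_def)

text \<open>The cube has a square in sheet \<open>i\<close> and another, one layer higher, in sheet
  \<open>i + 1\<close>. On these two sheets \<open>s\<close> is a positive multiple of the defect in
  the slice inequality, for \<open>k\<close> and \<open>k + 1\<close> respectively.\<close>

lemma cube_support:
  assumes "even (i + k + m)" "even (i' + j + m')"
  defines "s \<equiv> cube_normal k i m \<bullet> cone_point j i' m' - cube_offset k * layer_a j"
  shows "s \<le> 0" and "s = 0 \<longleftrightarrow> in_cube k (i' + 3 * i) (m' + 5 * m) j"
proof -
  define e d where "e = i' + 3 * i" and "d = m' + 5 * m"
  define t where "t = hexagon_cos d"
  define J K where "J = (15::real) ^ j" and "K = (15::real) ^ k"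
  have s: "s = (405 * K - 2, 10 - 135 * K) \<bullet> quarter_turn e (J + 2, 3 - 2 * J)
      + 490 * 5 ^ k * 3 ^ j * t - (13 + 675 * K) * (J + 2)"
    by (simp add: s_def cube_normal_def cone_point_def cube_offset_def layer_a_def layer_b_def
        quarter_turn_inner hexagon_inner e_def d_def t_def J_def K_def)
  have J1: "3 ^ j \<le> J" "1 \<le> J" and K1: "5 ^ k \<le> K" "1 \<le> K"
    unfolding J_def K_def by (auto intro: power_mono)
  have JK: "5 ^ k * 3 ^ j \<le> J * K"
    using mult_mono[OF K1(1) J1(1)] K1 by (simp add: mult.commute)
  have tJK: "490 * 5 ^ k * 3 ^ j * t \<le> 980 * (J * K)"
  proof -
    have "5 ^ k * 3 ^ j * t \<le> 5 ^ k * 3 ^ j * 2"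
      unfolding t_def by (intro mult_left_mono hexagon_cos_le) auto
    then show ?thesis using JK by linarith
  qed
  have JK1: "J \<le> J * K" "K \<le> J * K" using J1 K1 by simp_all
  have par: "even (d + e + j + k)" using assms(1,2) by (auto simp: e_def d_def)
  have iff: "c * (x - y) = 0 \<longleftrightarrow> x = y" "c * (x - y) \<le> 0 \<longleftrightarrow> x \<le> y" if "c > 0" for c x y :: real
    using that by (auto simp: mult_le_0_iff)
  have "s \<le> 0 \<and> (s = 0 \<longleftrightarrow> in_cube k e d j)"
    using mod_4_cases[of e]
  proof (elim disjE)
    assume e0: "e mod 4 = 0"
    then have "even e" by presburger
    then have "even (d + j + k)" using par by simp
    note sl = cube_slice_support[OF this]
    have "s = 35 * (14 * 5 ^ k * 3 ^ j * hexagon_cos d - (15 ^ j + 27 * 15 ^ k))"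
      using e0 by (simp add: s quarter_turn_def t_def J_def K_def inner_prod_def algebra_simps)
    then have "s \<le> 0" "s = 0 \<longleftrightarrow> cube_slice k d j" by (simp_all only: iff zero_less_numeral sl)
    then show ?thesis using e0 by (simp add: in_cube_def)
  next
    assume e1: "e mod 4 = 1"
    then have "odd e" by presburger
    then have "even (d + j + (k + 1))" using par by presburger
    note sl = cube_slice_support[OF this]
    have "s = 7 * (14 * 5 ^ (k + 1) * 3 ^ j * hexagon_cos d - (15 ^ j + 27 * 15 ^ (k + 1)))"
      using e1 by (simp add: s quarter_turn_def t_def J_def K_def inner_prod_def algebra_simps)
    then have "s \<le> 0" "s = 0 \<longleftrightarrow> cube_slice (k + 1) d j" by (simp_all only: iff zero_less_numeral sl)
    then show ?thesis using e1 by (simp add: in_cube_def)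
  next
    \<comment> \<open>The two sheets that miss the cube have slack: the phase term is at most
      \<open>980 * (J * K)\<close>, against \<open>- 1350 * (J * K)\<close>.\<close>
    assume e2: "e mod 4 = 2"
    have "s = 490 * 5 ^ k * 3 ^ j * t + 9 * J - 1350 * (J * K) - 52 - 1755 * K"
      using e2 by (simp add: s quarter_turn_def inner_prod_def algebra_simps)
    then have "s < 0" using tJK JK1 J1 K1 by linarith
    then show ?thesis using e2 by (simp add: in_cube_def)
  next
    assume e3: "e mod 4 = 3"
    have "s = 490 * 5 ^ k * 3 ^ j * t - 19 * J - 1350 * (J * K) - 52 + 135 * K"
      using e3 by (simp add: s quarter_turn_def inner_prod_def algebra_simps)
    then have "s < 0" using tJK JK1 J1 K1 by linarith
    then show ?thesis using e3 by (simp add: in_cube_def)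
  qed
  then show "s \<le> 0" and "s = 0 \<longleftrightarrow> in_cube k (i' + 3 * i) (m' + 5 * m) j"
    by (auto simp: e_def d_def)
qed

section \<open>Cubes meeting in a vertex or a square\<close>

lemma diff_mod_4_iff:
  assumes "c < 4" shows "((i'::nat) + 3 * i) mod 4 = c \<longleftrightarrow> i' mod 4 = (i + c) mod 4"
proof
  assume "(i' + 3 * i) mod 4 = c"
  then have "(c + i) mod 4 = (i' + 3 * i + i) mod 4" by (metis mod_add_left_eq)
  also have "i' + 3 * i + i = i' + 4 * i" by simp
  finally show "i' mod 4 = (i + c) mod 4" by (simp add: add.commute)
next
  assume "i' mod 4 = (i + c) mod 4"
  then have "(i' + 3 * i) mod 4 = (i + c + 3 * i) mod 4" by (metis mod_add_left_eq)
  also have "i + c + 3 * i = c + 4 * i" by simp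
  finally show "(i' + 3 * i) mod 4 = c" using assms by simp
qed

lemma diff_mod_6_iff:
  assumes "c < 6" shows "((m'::nat) + 5 * m) mod 6 = c \<longleftrightarrow> m' mod 6 = (m + c) mod 6"
proof
  assume "(m' + 5 * m) mod 6 = c"
  then have "(c + m) mod 6 = (m' + 5 * m + m) mod 6" by (metis mod_add_left_eq)
  also have "m' + 5 * m + m = m' + 6 * m" by simp
  finally show "m' mod 6 = (m + c) mod 6" by (simp add: add.commute)
next
  assume "m' mod 6 = (m + c) mod 6"
  then have "(m' + 5 * m) mod 6 = (m + c + 5 * m) mod 6" by (metis mod_add_left_eq)
  also have "m + c + 5 * m = c + 6 * m" by simp
  finally show "(m' + 5 * m) mod 6 = c" using assms by simp
qed

lemma in_cube_shift_sheet: "in_cube k (i' + 3 * (i + 3)) d j \<longleftrightarrow> in_cube k (i' + 3 * i + 1) d j"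
proof -
  have "i' + 3 * (i + 3) = (i' + 3 * i + 1) + 4 * 2" by simp
  then have "(i' + 3 * (i + 3)) mod 4 = (i' + 3 * i + 1) mod 4" by (metis mod_mult_self2)
  then show ?thesis by (simp add: in_cube_def)
qed

text \<open>The vertex is the bottom of the first cube and the top of the second: a cube's top lies
  three layers and one sheet beyond its bottom, in the same phase, and \<open>i + 3\<close> is one
  sheet back modulo 4.\<close>

lemma in_cube_vertex_iff:
  assumes "k \<ge> 3"
  shows "in_cube k (i' + 3 * i) (m' + 5 * m) j \<and> in_cube (k - 3) (i' + 3 * (i + 3)) (m' + 5 * m) j
     \<longleftrightarrow> j = k \<and> i' mod 4 = i mod 4 \<and> m' mod 6 = m mod 6"
proof -
  define e d where "e = i' + 3 * i" and "d = m' + 5 * m"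
  have 1: "(e + 1) mod 4 = (e mod 4 + 1) mod 4" by (simp add: mod_simps)
  have 3: "i' mod 4 = i mod 4 \<longleftrightarrow> e mod 4 = 0" "m' mod 6 = m mod 6 \<longleftrightarrow> d mod 6 = 0"
    unfolding e_def d_def
    by (subst diff_mod_4_iff, simp, simp, subst diff_mod_6_iff, simp, simp)
  obtain k' where k: "k = k' + 3" using assms by (metis add.commute le_Suc_ex)
  show ?thesis
    unfolding in_cube_shift_sheet
    unfolding e_def[symmetric] d_def[symmetric] in_cube_def cube_slice_def 1 3 k
    using mod_4_cases[of e] mod_6_cases[of d] by (elim disjE) auto
qed

text \<open>
  The square 2-faces below the vertex \<open>(k + 2, i, m)\<close>: intersections of the cube having this
  vertex as its top with three neighbouring cubes.
\<close>

lemma in_cube_square12_iff: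
  assumes "k \<ge> 1" and c: "c = 1 \<or> c = 5"
  shows "in_cube (k - 1) (i' + 3 * (i + 3)) (m' + 5 * m) j \<and> in_cube k (i' + 3 * (i + 3)) (m' + 5 * (m + c)) j
     \<longleftrightarrow> (j, i' mod 4, m' mod 6) \<in> {(k + 2, i mod 4, m mod 6), (k + 1, (i + 3) mod 4, m mod 6),
            (k + 1, i mod 4, (m + c) mod 6), (k, (i + 3) mod 4, (m + c) mod 6)}"
proof -
  define e d where "e = i' + 3 * i" and "d = m' + 5 * m"
  have 1: "(e + 1) mod 4 = (e mod 4 + 1) mod 4" "(d + 5 * c) mod 6 = (d mod 6 + 5 * c) mod 6"
    by (simp_all add: mod_simps)
  have 2: "m' + 5 * (m + c) = d + 5 * c" by (simp add: d_def)
  obtain k' where k: "k = k' + 1" using assms by (metis add.commute le_Suc_ex)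
  have 3: "i' mod 4 = i mod 4 \<longleftrightarrow> e mod 4 = 0" "i' mod 4 = (i + 3) mod 4 \<longleftrightarrow> e mod 4 = 3"
    "m' mod 6 = m mod 6 \<longleftrightarrow> d mod 6 = 0" "m' mod 6 = (m + c) mod 6 \<longleftrightarrow> d mod 6 = c"
    unfolding e_def d_def using c
    by (subst diff_mod_4_iff, simp, simp, subst diff_mod_4_iff, simp, simp,
        subst diff_mod_6_iff, simp, simp, subst diff_mod_6_iff, auto)
  show ?thesis
    unfolding in_cube_shift_sheet 2
    unfolding e_def[symmetric] d_def[symmetric] in_cube_def cube_slice_def 1
      insert_iff prod.inject 3 empty_iff
    using mod_4_cases[of e] mod_6_cases[of d] c by (elim disjE) (auto simp: k)
qed

lemma in_cube_square23_iff:
  assumes "k \<ge> 1"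
  shows "in_cube (k - 1) (i' + 3 * (i + 3)) (m' + 5 * m) j \<and> in_cube k (i' + 3 * i) (m' + 5 * m) j
     \<longleftrightarrow> (j, i' mod 4, m' mod 6) \<in> {(k + 2, i mod 4, m mod 6), (k + 1, i mod 4, (m + 5) mod 6),
            (k + 1, i mod 4, (m + 1) mod 6), (k, i mod 4, m mod 6)}"
proof -
  define e d where "e = i' + 3 * i" and "d = m' + 5 * m"
  have 1: "(e + 1) mod 4 = (e mod 4 + 1) mod 4" by (simp add: mod_simps)
  obtain k' where k: "k = k' + 1" using assms by (metis add.commute le_Suc_ex)
  have 3: "i' mod 4 = i mod 4 \<longleftrightarrow> e mod 4 = 0" "m' mod 6 = m mod 6 \<longleftrightarrow> d mod 6 = 0"
    "m' mod 6 = (m + 1) mod 6 \<longleftrightarrow> d mod 6 = 1" "m' mod 6 = (m + 5) mod 6 \<longleftrightarrow> d mod 6 = 5"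
    unfolding e_def d_def
    by (subst diff_mod_4_iff, simp, simp, subst diff_mod_6_iff, simp, simp,
        subst diff_mod_6_iff, simp, simp, subst diff_mod_6_iff, simp, simp)
  show ?thesis
    unfolding in_cube_shift_sheet
    unfolding e_def[symmetric] d_def[symmetric] in_cube_def cube_slice_def 1
      insert_iff prod.inject 3 empty_iff
    using mod_4_cases[of e] mod_6_cases[of d] by (elim disjE) (auto simp: k)
qed

section \<open>Planarity of the squares\<close>

text \<open>1 and 15 are the roots of \<open>x ^ 2 - 16 * x + 15\<close>, which settles the sheet
  coordinates. In the phase coordinates the two neighbours of a hexagon vertex add up to it, and 15
  + 9 = 8 * 3.\<close>

lemma cone_point_square23:
  "15 *\<^sub>R cone_point k i m + cone_point (k + 2) i m
     = 8 *\<^sub>R (cone_point (k + 1) i (m + 5) + cone_point (k + 1) i (m + 1))"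
proof -
  have e: "(m + 5) mod 6 = (m mod 6 + 5) mod 6" "Suc m mod 6 = Suc (m mod 6) mod 6"
    by (simp_all add: mod_simps)
  have "hexagon (m + 5) + hexagon (m + 1) = hexagon m"
    using mod_6_cases[of m] by (elim disjE) (simp_all add: hexagon_def e)
  then have "3 ^ (k + 1) *\<^sub>R hexagon (m + 5) + 3 ^ (k + 1) *\<^sub>R hexagon (m + 1) = 3 ^ (k + 1) *\<^sub>R hexagon m"
    by (metis scaleR_add_right)
  then show ?thesis
    using mod_4_cases[of i]
    by (elim disjE) (simp_all add: cone_point_def quarter_turn_def layer_a_def layer_b_def algebra_simps flip: scaleR_add_left)
qed

text \<open>The last homogeneous coordinate of the preceding relation. It gives both diagonals the
  same total weight, as \<open>segments_cross\<close> requires.\<close>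

lemma layer_a_square23: "15 * layer_a k + layer_a (k + 2) = 16 * layer_a (k + 1)"
  by (simp add: layer_a_def)

text \<open>The radii \<open>3 ^ j\<close> force the factor 3 within each phase; the ratio of
  \<open>45 * 15 ^ k - 1\<close> to \<open>9 * 15 ^ k - 3\<close> then balances the sheet
  coordinates.\<close>

lemma cone_point_square12:
  "(9 * (45 * 15 ^ k - 1)) *\<^sub>R cone_point k (i + 3) m' + (9 * 15 ^ k - 3) *\<^sub>R cone_point (k + 2) i m
     = (3 * (45 * 15 ^ k - 1)) *\<^sub>R cone_point (k + 1) i m' + (3 * (9 * 15 ^ k - 3)) *\<^sub>R cone_point (k + 1) (i + 3) m"
proof -
  have e: "(i + 3) mod 4 = (i mod 4 + 3) mod 4" by (simp add: mod_simps)
  define K where "K = (15::real) ^ k"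
  have K: "15 ^ (k + 1) = 15 * K" "15 ^ (k + 2) = 225 * K" by (simp_all add: K_def)
  show ?thesis
    using mod_4_cases[of i]
    by (elim disjE)
      (simp_all add: cone_point_def quarter_turn_def layer_a_def layer_b_def e K K_def[symmetric] algebra_simps)
qed

lemma layer_a_square12:
  "9 * (45 * 15 ^ k - 1) * layer_a k + (9 * 15 ^ k - 3) * layer_a (k + 2)
     = 3 * (45 * 15 ^ k - 1) * layer_a (k + 1) + 3 * (9 * 15 ^ k - 3) * layer_a (k + 1)"
  by (simp add: layer_a_def algebra_simps)

section \<open>The polytopes\<close>

lemma convex_hull_halfspace:
  assumes "\<And>y. y \<in> S \<Longrightarrow> a \<bullet> y \<le> c" "y \<in> convex hull S"
  shows "a \<bullet> y \<le> c"
proof -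
  have "convex hull S \<subseteq> {y. a \<bullet> y \<le> c}"
    by (rule hull_minimal) (use assms(1) convex_halfspace_le in auto)
  then show ?thesis using assms(2) by blast
qed

lemma supporting_face:
  assumes "\<And>y. y \<in> S \<Longrightarrow> a \<bullet> y \<le> c"
  shows "convex hull S \<inter> {y. a \<bullet> y = c} face_of convex hull S"
  by (rule face_of_Int_supporting_hyperplane_le[OF convex_convex_hull convex_hull_halfspace[OF assms]])

text \<open>The supporting face has an extreme point; this lies in \<open>S\<close> and on the
  hyperplane, so it is \<open>x\<close>.\<close>

lemma exposed_point_in_vertices:
  assumes "finite S" "x \<in> S" "a \<bullet> x = c" and less: "\<And>y. y \<in> S \<Longrightarrow> y \<noteq> x \<Longrightarrow> a \<bullet> y < c"
  shows "x \<in> vertices (convex hull S)"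
proof -
  define F where "F = convex hull S \<inter> {y. a \<bullet> y = c}"
  have face: "F face_of convex hull S"
    unfolding F_def by (rule supporting_face) (use less assms(3) less_imp_le in blast)
  have "compact (convex hull S)" using assms(1) by (simp add: finite_imp_compact_convex_hull)
  then have "compact F" "convex F"
    using face_of_imp_compact[OF convex_convex_hull _ face] face_of_imp_convex[OF face] by auto
  moreover have "x \<in> F" using assms hull_subset[of S convex] by (auto simp: F_def)
  ultimately obtain z where z: "z extreme_point_of F"
    using extreme_point_exists_convex[of F] by blast
  then have "z extreme_point_of convex hull S" using face by (simp add: extreme_point_of_face)
  moreover from this have "z \<in> S" by (rule extreme_point_of_convex_hull)
  moreover have "a \<bullet> z = c" using z by (auto simp: extreme_point_of_def F_def)
  ultimately have "x extreme_point_of convex hull S" using less[of z] by force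
  then show ?thesis by (simp add: vertices_def)
qed

lemma segments_cross:
  fixes w x y z :: "'a::euclidean_space"
  assumes pos: "A > 0" "B > 0" "C > 0" "D > 0" and sum: "A + B = C + D"
    and eq: "A *\<^sub>R z + B *\<^sub>R w = C *\<^sub>R x + D *\<^sub>R y" and "x \<noteq> y"
  shows "open_segment x y \<inter> closed_segment w z \<noteq> {}"
proof -
  define u where "u = (1 / (C + D)) *\<^sub>R (C *\<^sub>R x + D *\<^sub>R y)"
  have "u = (1 - D / (C + D)) *\<^sub>R x + (D / (C + D)) *\<^sub>R y"
  proof -
    have "1 - D / (C + D) = C / (C + D)" using pos by (simp add: field_simps)
    then show ?thesis by (simp add: u_def scaleR_add_right)
  qed
  then have "u \<in> open_segment x y"
    using pos \<open>x \<noteq> y\<close> by (auto simp: in_segment intro!: exI[of _ "D / (C + D)"])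
  moreover have "u = (1 - A / (A + B)) *\<^sub>R w + (A / (A + B)) *\<^sub>R z"
  proof -
    have "1 - A / (A + B) = B / (A + B)" using pos by (simp add: field_simps)
    then show ?thesis by (simp add: u_def eq[symmetric] sum[symmetric] scaleR_add_right add.commute)
  qed
  then have "u \<in> closed_segment w z"
    using pos by (auto simp: in_segment intro!: exI[of _ "A / (A + B)"])
  ultimately show ?thesis by blast
qed

lemma layer_a_pos: "layer_a j > 0"
  by (simp add: layer_a_def add_pos_pos)

lemma cube_offset_pos: "cube_offset k > 0"
  by (simp add: cube_offset_def add_pos_pos)

lemma add_mod_neq:
  fixes m c n :: nat
  assumes "0 < c" "c < n"
  shows "(m + c) mod n \<noteq> m mod n"
proof
  assume "(m + c) mod n = m mod n"
  then have "n dvd c" using mod_eq_dvd_iff_nat[of m "m + c" n] by simp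
  then show False using assms nat_dvd_not_less by blast
qed

lemma add_5_mod_6_neq: "((m::nat) + 5) mod 6 \<noteq> (m + 1) mod 6"
proof -
  have "(m + 1 + 4) mod 6 \<noteq> (m + 1) mod 6" by (rule add_mod_neq) simp_all
  moreover have "m + 1 + 4 = m + 5" by simp
  ultimately show ?thesis by metis
qed

text \<open>Four coordinate axes carry the 4-dimensional base; the unit vectors of the remaining
  axes become the apexes of the iterated pyramid.\<close>

locale four_axes =
  fixes i0 i1 i2 i3 :: "'n::finite"
  assumes distinct_axes: "distinct [i0, i1, i2, i3]"
begin

definition embed :: "(real \<times> real) \<times> (real \<times> real) \<Rightarrow> real ^ 'n" where
  "embed p = fst (fst p) *\<^sub>R axis i0 1 + snd (fst p) *\<^sub>R axis i1 1
           + fst (snd p) *\<^sub>R axis i2 1 + snd (snd p) *\<^sub>R axis i3 1"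

definition apexes :: "(real ^ 'n) set" where
  "apexes = (\<lambda>l. axis l 1) ` (- {i0, i1, i2, i3})"

definition base_point :: "nat \<Rightarrow> nat \<Rightarrow> nat \<Rightarrow> real ^ 'n" where
  "base_point j i m = embed ((1 / layer_a j) *\<^sub>R cone_point j i m)"

text \<open>Layers start at 3 because the vertex in layer \<open>j\<close> is exposed with the help
  of a cube whose bottom is in layer \<open>j - 3\<close>. The parity condition comes from the
  tiling, where \<open>i + j + m\<close> is congruent to \<open>2 * z1 + 2 * z2\<close> modulo
  2.\<close>

definition base :: "nat \<Rightarrow> (real ^ 'n) set" where
  "base n = {base_point j i m | j i m. 3 \<le> j \<and> j \<le> n + 3 \<and> even (i + j + m)}"

definition tower :: "nat \<Rightarrow> (real ^ 'n) set" where
  "tower n = convex hull (base n \<union> apexes)"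

lemma embed_add: "embed (p + q) = embed p + embed q"
  by (simp add: embed_def scaleR_add_left)

lemma embed_scaleR: "embed (c *\<^sub>R p) = c *\<^sub>R embed p"
  by (simp add: embed_def scaleR_add_right)

lemma embed_inner: "embed p \<bullet> embed q = p \<bullet> q"
proof -
  have "i0 \<noteq> i1" "i0 \<noteq> i2" "i0 \<noteq> i3" "i1 \<noteq> i2" "i1 \<noteq> i3" "i2 \<noteq> i3"
    using distinct_axes by auto
  note ne = this this[symmetric]
  show ?thesis
    by (simp add: embed_def inner_add_left inner_add_right inner_axis_axis inner_prod_def ne)
qed

lemma embed_inner_apex:
  assumes "x \<in> apexes" shows "embed p \<bullet> x = 0"
proof -
  obtain l where l: "x = axis l 1" "i0 \<noteq> l" "i1 \<noteq> l" "i2 \<noteq> l" "i3 \<noteq> l"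
    using assms by (auto simp: apexes_def)
  then show ?thesis by (simp add: embed_def inner_add_left inner_axis_axis)
qed

lemma apex_inner: "x \<in> apexes \<Longrightarrow> y \<in> apexes \<Longrightarrow> x \<bullet> y = (if x = y then 1 else 0)"
  by (auto simp: apexes_def inner_axis_axis axis_eq_axis)

lemma scaleR_base_point: "layer_a j *\<^sub>R base_point j i m = embed (cone_point j i m)"
  using layer_a_pos[of j] by (simp add: base_point_def embed_scaleR)

lemma base_point_cong:
  "i mod 4 = i' mod 4 \<Longrightarrow> m mod 6 = m' mod 6 \<Longrightarrow> base_point j i m = base_point j i' m'"
  by (simp add: base_point_def cone_point_cong[of i i' m m'])

lemma base_pointI: "3 \<le> j \<Longrightarrow> j \<le> n + 3 \<Longrightarrow> even (i + j + m) \<Longrightarrow> base_point j i m \<in> base n"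
  by (auto simp: base_def)

lemma cube_supports_base_point:
  assumes "even (i + k + m)" "even (i' + j + m')"
  shows "embed (cube_normal k i m) \<bullet> base_point j i' m' \<le> cube_offset k"
    and "embed (cube_normal k i m) \<bullet> base_point j i' m' = cube_offset k
           \<longleftrightarrow> in_cube k (i' + 3 * i) (m' + 5 * m) j"
proof -
  define s where "s = cube_normal k i m \<bullet> cone_point j i' m' - cube_offset k * layer_a j"
  have "embed (cube_normal k i m) \<bullet> base_point j i' m' - cube_offset k = s / layer_a j"
    using layer_a_pos[of j]
    by (simp add: s_def base_point_def embed_inner diff_divide_distrib)
  moreover have "s \<le> 0" "s = 0 \<longleftrightarrow> in_cube k (i' + 3 * i) (m' + 5 * m) j"
    using cube_support[OF assms] by (simp_all add: s_def)
  moreover have "s / layer_a j \<le> 0 \<longleftrightarrow> s \<le> 0" "s / layer_a j = 0 \<longleftrightarrow> s = 0"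
    using layer_a_pos[of j] by (simp_all add: divide_le_0_iff)
  ultimately show "embed (cube_normal k i m) \<bullet> base_point j i' m' \<le> cube_offset k"
    and "embed (cube_normal k i m) \<bullet> base_point j i' m' = cube_offset k
           \<longleftrightarrow> in_cube k (i' + 3 * i) (m' + 5 * m) j"
    by (smt (verit))+
qed

text \<open>A sum of two supporting functionals attains the sum of the bounds only where both are
  attained. Apexes are orthogonal to the embedded normals, and the offsets are positive.\<close>

lemma two_cubes_support:
  assumes par: "even (i + k + m)" "even (il + kl + ml)"
  defines "a \<equiv> embed (cube_normal k i m) + embed (cube_normal kl il ml)"
    and "c \<equiv> cube_offset k + cube_offset kl"
  shows "even (i' + j + m') \<Longrightarrow> a \<bullet> base_point j i' m' \<le> c"
    and "even (i' + j + m') \<Longrightarrow> a \<bullet> base_point j i' m' = c \<longleftrightarrow>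
      in_cube k (i' + 3 * i) (m' + 5 * m) j \<and> in_cube kl (i' + 3 * il) (m' + 5 * ml) j"
    and "x \<in> apexes \<Longrightarrow> a \<bullet> x < c"
proof -
  assume "even (i' + j + m')"
  note s1 = cube_supports_base_point[OF par(1) this] and s2 = cube_supports_base_point[OF par(2) this]
  show "a \<bullet> base_point j i' m' \<le> c"
    using s1(1) s2(1) by (simp add: a_def c_def inner_add_left)
  show "a \<bullet> base_point j i' m' = c \<longleftrightarrow>
      in_cube k (i' + 3 * i) (m' + 5 * m) j \<and> in_cube kl (i' + 3 * il) (m' + 5 * ml) j"
    unfolding s1(2)[symmetric] s2(2)[symmetric] using s1(1) s2(1)
    by (auto simp: a_def c_def inner_add_left)
next
  assume "x \<in> apexes"
  then show "a \<bullet> x < c"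
    using cube_offset_pos[of k] cube_offset_pos[of kl]
    by (simp add: a_def c_def inner_add_left embed_inner_apex)
qed

lemma base_point_eq_iff:
  assumes "3 \<le> j" "even (i + j + m)" "even (i' + j' + m')"
  shows "base_point j' i' m' = base_point j i m \<longleftrightarrow> j' = j \<and> i' mod 4 = i mod 4 \<and> m' mod 6 = m mod 6"
proof
  assume eq: "base_point j' i' m' = base_point j i m"
  have par: "even (i + 3 + (j - 3) + m)" using assms(1,2) by auto
  note two = two_cubes_support(2)[OF assms(2) par]
  show "j' = j \<and> i' mod 4 = i mod 4 \<and> m' mod 6 = m mod 6"
    using two[OF assms(3)] two[OF assms(2)] in_cube_vertex_iff[OF assms(1), of i' i m' m j']
      in_cube_vertex_iff[OF assms(1), of i i m m j] eq by simp
next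
  assume "j' = j \<and> i' mod 4 = i mod 4 \<and> m' mod 6 = m mod 6"
  then show "base_point j' i' m' = base_point j i m" using base_point_cong by blast
qed

text \<open>Parity leaves three of the six phases for given layer and sheet, hence 4 * 3 = 12 points
  in each layer.\<close>

lemma base_eq_image:
  "base n = (\<lambda>(j, i, q). base_point j i (2 * q + (i + j) mod 2)) ` ({3..n + 3} \<times> {..<4} \<times> {..<3})"
    (is "_ = ?R")
proof
  show "?R \<subseteq> base n"
    by (auto simp: base_def) (metis even_add even_mult_iff even_mod_2_iff dvd_refl)
  show "base n \<subseteq> ?R"
  proof
    fix x assume "x \<in> base n"
    then obtain j i m where x: "x = base_point j i m" "3 \<le> j" "j \<le> n + 3" "even (i + j + m)"
      by (auto simp: base_def)
    define q where "q = (m mod 6) div 2"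
    have "m mod 6 mod 2 = m mod 2" "i mod 4 mod 2 = i mod 2" by (simp_all add: mod_mod_cancel)
    moreover have "(i mod 4 + j) mod 2 = (i mod 4 mod 2 + j) mod 2" "(i + j) mod 2 = (i mod 2 + j) mod 2"
      by (rule mod_add_left_eq[symmetric])+
    moreover have "m mod 2 = (i + j) mod 2" using x(4) by presburger
    ultimately have "m mod 6 mod 2 = (i mod 4 + j) mod 2" by simp
    moreover have "m mod 6 = 2 * (m mod 6 div 2) + m mod 6 mod 2" by (rule mult_div_mod_eq[symmetric])
    ultimately have "m mod 6 = 2 * q + (i mod 4 + j) mod 2" unfolding q_def by metis
    moreover have "m mod 6 < 6" by simp
    ultimately have "x = base_point j (i mod 4) (2 * q + (i mod 4 + j) mod 2)" "q < 3"
      unfolding x(1) by (auto intro!: base_point_cong)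
    then show "x \<in> ?R" using x(2,3) by (auto intro!: image_eqI[of _ _ "(j, i mod 4, q)"])
  qed
qed

lemma finite_base: "finite (base n)"
  by (simp add: base_eq_image)

lemma card_base: "card (base n) = 12 * (n + 1)"
proof -
  have "inj_on (\<lambda>(j, i, q). base_point j i (2 * q + (i + j) mod 2)) ({3..n + 3} \<times> {..<4} \<times> {..<3})"
  proof (rule inj_onI)
    fix z z' assume zz: "z \<in> {3..n + 3} \<times> {..<4} \<times> {..<3}" "z' \<in> {3..n + 3} \<times> {..<4} \<times> {..<3}"
      "(\<lambda>(j, i, q). base_point j i (2 * q + (i + j) mod 2)) z = (\<lambda>(j, i, q). base_point j i (2 * q + (i + j) mod 2)) z'"
    obtain j i q j' i' q' where z: "z = (j, i, q)" "z' = (j', i', q')" by (metis prod_cases3)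
    have a: "j \<in> {3..n + 3}" "i \<in> {..<4}" "q \<in> {..<3}" "j' \<in> {3..n + 3}" "i' \<in> {..<4}" "q' \<in> {..<3}"
      and eq: "base_point j i (2 * q + (i + j) mod 2) = base_point j' i' (2 * q' + (i' + j') mod 2)"
      using zz by (auto simp: z)
    have par: "even (i + j + (2 * q + (i + j) mod 2))" "even (i' + j' + (2 * q' + (i' + j') mod 2))"
      by presburger+
    have b: "j = j'" "i mod 4 = i' mod 4" "(2 * q + (i + j) mod 2) mod 6 = (2 * q' + (i' + j') mod 2) mod 6"
      using base_point_eq_iff[of j' i' _ i j] par a eq by auto
    have "i = i'" using b(2) a by simp
    moreover have "2 * q + (i + j) mod 2 < 6" "2 * q' + (i' + j') mod 2 < 6" using a by auto
    ultimately show "z = z'" using b by (simp add: z)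
  qed
  then show ?thesis by (simp add: base_eq_image card_image card_cartesian_product)
qed

lemma finite_apexes: "finite apexes"
  by (simp add: apexes_def)

lemma card_apexes: "card apexes = CARD('n) - 4"
proof -
  have "inj_on (\<lambda>l. axis l (1::real) :: real ^ 'n) (- {i0, i1, i2, i3})"
    by (auto simp: inj_on_def axis_eq_axis)
  then have "card apexes = card (- {i0, i1, i2, i3})" by (simp add: apexes_def card_image)
  also have "\<dots> = CARD('n) - card {i0, i1, i2, i3}" by (simp add: Compl_eq_Diff_UNIV card_Diff_subset)
  also have "card {i0, i1, i2, i3} = 4" using distinct_axes by simp
  finally show ?thesis .
qed

lemma apex_inner_base: "x \<in> apexes \<Longrightarrow> y \<in> base n \<Longrightarrow> x \<bullet> y = 0"
  by (auto simp: base_def base_point_def inner_commute[of x] embed_inner_apex)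

lemma base_apexes_disjoint: "base n \<inter> apexes = {}"
  using apex_inner_base[of _ _ n] apex_inner by (auto simp: disjoint_iff) (metis zero_neq_one)

lemma vertices_tower: "vertices (tower n) = base n \<union> apexes"
proof
  show "vertices (tower n) \<subseteq> base n \<union> apexes"
    unfolding tower_def vertices_def by (rule extreme_points_of_convex_hull)
  have "x \<in> vertices (tower n)" if x: "x \<in> apexes" for x
    unfolding tower_def
  proof (rule exposed_point_in_vertices[where a = x and c = 1])
    show "x \<bullet> y < 1" if "y \<in> base n \<union> apexes" "y \<noteq> x" for y
      using that x apex_inner_base[OF x] apex_inner[OF x] by auto
  qed (use x apex_inner finite_base finite_apexes in auto)
  moreover have "x \<in> vertices (tower n)" if x: "x \<in> base n" for x
  proof -
    obtain j i m where z: "x = base_point j i m" "3 \<le> j" "j \<le> n + 3" "even (i + j + m)"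
      using x by (auto simp: base_def)
    have par: "even (i + 3 + (j - 3) + m)" using z by auto
    note two = two_cubes_support[OF z(4) par]
    show ?thesis
      unfolding tower_def
    proof (rule exposed_point_in_vertices)
      show "finite (base n \<union> apexes)" "x \<in> base n \<union> apexes" using x finite_base finite_apexes by auto
      show "(embed (cube_normal j i m) + embed (cube_normal (j - 3) (i + 3) m)) \<bullet> x = cube_offset j + cube_offset (j - 3)"
        using two(2)[OF z(4)] in_cube_vertex_iff[OF z(2), of i i m m j] z(1) by simp
      show "(embed (cube_normal j i m) + embed (cube_normal (j - 3) (i + 3) m)) \<bullet> y < cube_offset j + cube_offset (j - 3)"
        if y: "y \<in> base n \<union> apexes" "y \<noteq> x" for y
      proof (cases "y \<in> apexes")
        case True
        then show ?thesis by (rule two(3))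
      next
        case False
        then obtain j' i' m' where y': "y = base_point j' i' m'" "even (i' + j' + m')"
          using y by (auto simp: base_def)
        have "\<not> (j' = j \<and> i' mod 4 = i mod 4 \<and> m' mod 6 = m mod 6)"
          using y(2) base_point_cong y'(1) z(1) by blast
        then show ?thesis
          using two(1)[OF y'(2)] two(2)[OF y'(2)] in_cube_vertex_iff[OF z(2), of i' i m' m j']
          unfolding y'(1) by (metis order_le_less)
      qed
    qed
  qed
  ultimately show "base n \<union> apexes \<subseteq> vertices (tower n)" by blast
qed

lemma polytope_tower: "polytope (tower n)"
  unfolding tower_def polytope_def using finite_base finite_apexes by blast

lemma card_vertices_tower: "card (vertices (tower n)) = 12 * (n + 1) + (CARD('n) - 4)"
  by (simp add: vertices_tower card_Un_disjoint finite_base finite_apexes base_apexes_disjoint card_base card_apexes)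

lemma aff_dim_tower: "aff_dim (tower n) = int CARD('n)"
proof -
  have "aff_dim (base n \<union> apexes) = int CARD('n)"
  proof (rule ccontr)
    assume "aff_dim (base n \<union> apexes) \<noteq> int CARD('n)"
    then have "aff_dim (base n \<union> apexes) < DIM(real ^ 'n)"
      using aff_dim_le_DIM[of "base n \<union> apexes"] by simp
    then obtain a b where a: "a \<noteq> 0" "base n \<union> apexes \<subseteq> {x. a \<bullet> x = b}"
      by (rule aff_lowdim_subset_hyperplane)
    have eq: "a \<bullet> embed (cone_point 3 i m) = b * layer_a 3" if "odd (i + m)" for i m
    proof -
      have "base_point 3 i m \<in> base n" using that by (intro base_pointI) auto
      then have "a \<bullet> (layer_a 3 *\<^sub>R base_point 3 i m) = layer_a 3 * b" using a(2) by auto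
      then show ?thesis by (simp add: scaleR_base_point mult.commute)
    qed
    have e: "a \<bullet> embed p = fst (fst p) * a $ i0 + snd (fst p) * a $ i1 + fst (snd p) * a $ i2 + snd (snd p) * a $ i3" for p
      by (simp add: embed_def inner_add_right inner_axis)
    \<comment> \<open>Opposite sheets at equal phase separate the sheet coordinates from the phase
      coordinates; the opposite phases 0 and 3 then give \<open>b = 0\<close>.\<close>
    note eqs = eq[of 0 1] eq[of 2 1] eq[of 1 0] eq[of 3 0] eq[of 0 3] eq[of 0 5]
    have "a $ i0 = 0 \<and> a $ i1 = 0 \<and> a $ i2 = 0 \<and> a $ i3 = 0 \<and> b = 0"
      using eqs by (simp add: e cone_point_def quarter_turn_def hexagon_def layer_a_def layer_b_def)
    moreover have "a $ l = 0" if "l \<notin> {i0, i1, i2, i3}" for l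
    proof -
      have "a \<bullet> axis l 1 = b" using a(2) that by (auto simp: apexes_def)
      then show ?thesis using calculation by (simp add: inner_axis)
    qed
    ultimately have "a $ l = 0" for l by (cases "l \<in> {i0, i1, i2, i3}") auto
    then have "a = 0" by (simp add: vec_eq_iff)
    then show False using a(1) by blast
  qed
  then show ?thesis by (simp add: tower_def aff_dim_convex_hull)
qed

section \<open>Square faces of the towers\<close>

lemma two_cubes_face:
  assumes par: "even (i1' + k1 + m1)" "even (i2' + k2 + m2)"
    and valid: "\<And>j i m. (j, i, m) \<in> Z \<Longrightarrow> 3 \<le> j \<and> j \<le> n + 3 \<and> even (i + j + m)"
    and iff: "\<And>j i m. in_cube k1 (i + 3 * i1') (m + 5 * m1) j \<and> in_cube k2 (i + 3 * i2') (m + 5 * m2) j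
       \<longleftrightarrow> (j, i mod 4, m mod 6) \<in> (\<lambda>(j, i, m). (j, i mod 4, m mod 6)) ` Z"
  shows "\<exists>F. F face_of tower n \<and> F \<inter> vertices (tower n) = (\<lambda>(j, i, m). base_point j i m) ` Z"
proof -
  define a c where "a = embed (cube_normal k1 i1' m1) + embed (cube_normal k2 i2' m2)"
    and "c = cube_offset k1 + cube_offset k2"
  note two = two_cubes_support[OF par, folded a_def c_def]
  define F where "F = tower n \<inter> {y. a \<bullet> y = c}"
  have "F face_of tower n"
    unfolding F_def tower_def
  proof (rule supporting_face)
    fix y assume "y \<in> base n \<union> apexes"
    then show "a \<bullet> y \<le> c" using two(1) two(3) by (auto simp: base_def less_imp_le)
  qed
  moreover have "F \<inter> vertices (tower n) = (\<lambda>(j, i, m). base_point j i m) ` Z"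
  proof
    show "F \<inter> vertices (tower n) \<subseteq> (\<lambda>(j, i, m). base_point j i m) ` Z"
    proof
      fix x assume x: "x \<in> F \<inter> vertices (tower n)"
      then have ax: "a \<bullet> x = c" by (simp add: F_def)
      then have "x \<in> base n" using x two(3)[of x] by (auto simp: vertices_tower)
      then obtain j i m where z: "x = base_point j i m" "even (i + j + m)" by (auto simp: base_def)
      then have "(j, i mod 4, m mod 6) \<in> (\<lambda>(j, i, m). (j, i mod 4, m mod 6)) ` Z"
        using two(2)[OF z(2)] ax iff[of i m j] by simp
      then obtain i' m' where "(j, i', m') \<in> Z" "i mod 4 = i' mod 4" "m mod 6 = m' mod 6" by auto
      then show "x \<in> (\<lambda>(j, i, m). base_point j i m) ` Z"
        using base_point_cong[of i i' m m' j] z(1) by force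
    qed
    show "(\<lambda>(j, i, m). base_point j i m) ` Z \<subseteq> F \<inter> vertices (tower n)"
    proof clarify
      fix j i m assume z: "(j, i, m) \<in> Z"
      have b: "base_point j i m \<in> base n" using valid[OF z] by (auto intro: base_pointI)
      moreover have "a \<bullet> base_point j i m = c"
      proof -
        have "(j, i mod 4, m mod 6) \<in> (\<lambda>(j, i, m). (j, i mod 4, m mod 6)) ` Z" using z by force
        then show ?thesis using two(2)[of i j m] valid[OF z] iff[of i m j] by simp
      qed
      ultimately show "base_point j i m \<in> F \<inter> vertices (tower n)"
        using vertices_subset[of "tower n"] by (auto simp: F_def vertices_tower)
    qed
  qed
  ultimately show ?thesis by blast
qed

lemma square12:
  assumes k: "3 \<le> k" "k + 2 \<le> n + 3" and par: "even (i + k + m)" and c: "c = 1 \<or> c = 5"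
  shows "square_face (tower n) (base_point (k + 2) i m) (base_point (k + 1) (i + 3) m)
           (base_point (k + 1) i (m + c)) (base_point k (i + 3) (m + c))"
  unfolding square_face_def
proof (intro conjI)
  have par': "even (i + (k + 2) + m)" "even (i + 3 + (k + 1) + m)" "even (i + (k + 1) + (m + c))"
    "even (i + 3 + k + (m + c))" "even (i + 3 + (k - 1) + m)"
    using par c k by auto
  have ne: "(i + 3) mod 4 \<noteq> i mod 4" "(m + c) mod 6 \<noteq> m mod 6"
    by (rule add_mod_neq, simp, simp, rule add_mod_neq) (use c in auto)
  show "distinct [base_point (k + 2) i m, base_point (k + 1) (i + 3) m,
           base_point (k + 1) i (m + c), base_point k (i + 3) (m + c)]"
    using k par' ne by (simp add: base_point_eq_iff)
  let ?Z = "{(k + 2, i, m), (k + 1, i + 3, m), (k + 1, i, m + c), (k, i + 3, m + c)}"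
  have "\<exists>F. F face_of tower n \<and> F \<inter> vertices (tower n) = (\<lambda>(j, i, m). base_point j i m) ` ?Z"
  proof (rule two_cubes_face[OF par'(5) par'(4)])
    show "3 \<le> j' \<and> j' \<le> n + 3 \<and> even (i' + j' + m')" if "(j', i', m') \<in> ?Z" for j' i' m'
      using that k par' by auto
    show "in_cube (k - 1) (i' + 3 * (i + 3)) (m' + 5 * m) j \<and> in_cube k (i' + 3 * (i + 3)) (m' + 5 * (m + c)) j
       \<longleftrightarrow> (j, i' mod 4, m' mod 6) \<in> (\<lambda>(j, i, m). (j, i mod 4, m mod 6)) ` ?Z" for j i' m'
      using in_cube_square12_iff[OF _ c, of k i' i m' m j] k by simp
  qed
  then show "\<exists>F. F face_of tower n \<and> F \<inter> vertices (tower n) =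
      {base_point (k + 2) i m, base_point (k + 1) (i + 3) m, base_point (k + 1) i (m + c), base_point k (i + 3) (m + c)}"
    by simp
  have "(15::real) ^ k \<ge> 1" by simp
  then have st: "(45::real) * 15 ^ k - 1 > 0" "(9::real) * 15 ^ k - 3 > 0" by linarith+
  show "open_segment (base_point (k + 1) (i + 3) m) (base_point (k + 1) i (m + c)) \<inter>
      closed_segment (base_point (k + 2) i m) (base_point k (i + 3) (m + c)) \<noteq> {}"
  proof (rule segments_cross)
    show "9 * (45 * 15 ^ k - 1) * layer_a k > 0" "(9 * 15 ^ k - 3) * layer_a (k + 2) > 0"
      "3 * (9 * 15 ^ k - 3) * layer_a (k + 1) > 0" "3 * (45 * 15 ^ k - 1) * layer_a (k + 1) > 0"
      using st layer_a_pos by simp_all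
    show "9 * (45 * 15 ^ k - 1) * layer_a k + (9 * 15 ^ k - 3) * layer_a (k + 2) =
        3 * (9 * 15 ^ k - 3) * layer_a (k + 1) + 3 * (45 * 15 ^ k - 1) * layer_a (k + 1)"
      using layer_a_square12[of k] by linarith
    show "(9 * (45 * 15 ^ k - 1) * layer_a k) *\<^sub>R base_point k (i + 3) (m + c) +
        ((9 * 15 ^ k - 3) * layer_a (k + 2)) *\<^sub>R base_point (k + 2) i m =
        (3 * (9 * 15 ^ k - 3) * layer_a (k + 1)) *\<^sub>R base_point (k + 1) (i + 3) m +
        (3 * (45 * 15 ^ k - 1) * layer_a (k + 1)) *\<^sub>R base_point (k + 1) i (m + c)"
      unfolding scaleR_scaleR[symmetric] scaleR_base_point
      using arg_cong[OF cone_point_square12[of k i "m + c" m], of embed]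
      unfolding embed_add embed_scaleR by (simp only: scaleR_scaleR add.commute)
    show "base_point (k + 1) (i + 3) m \<noteq> base_point (k + 1) i (m + c)"
      using k par' ne by (simp add: base_point_eq_iff)
  qed
qed

lemma square23:
  assumes k: "3 \<le> k" "k + 2 \<le> n + 3" and par: "even (i + k + m)"
  shows "square_face (tower n) (base_point (k + 2) i m) (base_point (k + 1) i (m + 5))
           (base_point (k + 1) i (m + 1)) (base_point k i m)"
  unfolding square_face_def
proof (intro conjI)
  have par': "even (i + (k + 2) + m)" "even (i + (k + 1) + (m + 5))" "even (i + (k + 1) + (m + 1))"
    "even (i + k + m)" "even (i + 3 + (k - 1) + m)"
    using par k by auto
  have ne: "(m + 5) mod 6 \<noteq> (m + 1) mod 6"
    by (rule add_5_mod_6_neq)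
  show "distinct [base_point (k + 2) i m, base_point (k + 1) i (m + 5),
           base_point (k + 1) i (m + 1), base_point k i m]"
    using k par' ne by (simp add: base_point_eq_iff)
  let ?Z = "{(k + 2, i, m), (k + 1, i, m + 5), (k + 1, i, m + 1), (k, i, m)}"
  have "\<exists>F. F face_of tower n \<and> F \<inter> vertices (tower n) = (\<lambda>(j, i, m). base_point j i m) ` ?Z"
  proof (rule two_cubes_face[OF par'(5) par'(4)])
    show "3 \<le> j' \<and> j' \<le> n + 3 \<and> even (i' + j' + m')" if "(j', i', m') \<in> ?Z" for j' i' m'
      using that k par' by auto
    show "in_cube (k - 1) (i' + 3 * (i + 3)) (m' + 5 * m) j \<and> in_cube k (i' + 3 * i) (m' + 5 * m) j
       \<longleftrightarrow> (j, i' mod 4, m' mod 6) \<in> (\<lambda>(j, i, m). (j, i mod 4, m mod 6)) ` ?Z" for j i' m'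
      using in_cube_square23_iff[of k i' i m' m j] k by simp
  qed
  then show "\<exists>F. F face_of tower n \<and> F \<inter> vertices (tower n) =
      {base_point (k + 2) i m, base_point (k + 1) i (m + 5), base_point (k + 1) i (m + 1), base_point k i m}"
    by simp
  show "open_segment (base_point (k + 1) i (m + 5)) (base_point (k + 1) i (m + 1)) \<inter>
      closed_segment (base_point (k + 2) i m) (base_point k i m) \<noteq> {}"
  proof (rule segments_cross)
    show "15 * layer_a k > 0" "layer_a (k + 2) > 0" "8 * layer_a (k + 1) > 0" "8 * layer_a (k + 1) > 0"
      using layer_a_pos by simp_all
    show "15 * layer_a k + layer_a (k + 2) = 8 * layer_a (k + 1) + 8 * layer_a (k + 1)"
      using layer_a_square23[of k] by linarith
    show "(15 * layer_a k) *\<^sub>R base_point k i m + layer_a (k + 2) *\<^sub>R base_point (k + 2) i m =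
        (8 * layer_a (k + 1)) *\<^sub>R base_point (k + 1) i (m + 5) + (8 * layer_a (k + 1)) *\<^sub>R base_point (k + 1) i (m + 1)"
      unfolding scaleR_scaleR[symmetric] scaleR_base_point
      using arg_cong[OF cone_point_square23[of k i m], of embed]
      unfolding embed_add embed_scaleR by (simp only: scaleR_add_right)
    show "base_point (k + 1) i (m + 5) \<noteq> base_point (k + 1) i (m + 1)"
      using k par' ne by (simp add: base_point_eq_iff)
  qed
qed

section \<open>Determination by the first two layers\<close>

lemma realizes_tower_determined:
  assumes r: "realizes (tower n) v" and r': "realizes (tower n) v'" and "n \<ge> 1"
    and agree: "\<And>x. x \<in> base 1 \<union> apexes \<Longrightarrow> v' x = v x"
    and x: "x \<in> vertices (tower n)"
  shows "v' x = v x"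
proof -
  have "\<forall>i m. even (i + j + m) \<longrightarrow> v' (base_point j i m) = v (base_point j i m)"
    if "3 \<le> j" "j \<le> n + 3" for j
    using that
  proof (induction j rule: less_induct)
    case (less j)
    show ?case
    proof (intro allI impI)
      fix i m assume par: "even (i + j + m)"
      show "v' (base_point j i m) = v (base_point j i m)"
      proof (cases "j \<le> 4")
        case True
        then have "base_point j i m \<in> base 1" using less.prems par by (intro base_pointI) auto
        then show ?thesis using agree by blast
      next
        case False
        then obtain k where j: "j = k + 2" "3 \<le> k"
          by (intro that[of "j - 2"]) auto
        have k: "3 \<le> k" "k + 2 \<le> n + 3" "even (i + k + m)" using j less.prems par by auto
        have c: "(1::nat) = 1 \<or> (1::nat) = 5" "(5::nat) = 1 \<or> (5::nat) = 5" by auto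
        have par': "even (i + 3 + (k + 1) + m)" "even (i + (k + 1) + (m + 5))" "even (i + (k + 1) + (m + 1))"
          "even (i + 3 + k + (m + 5))" "even (i + 3 + k + (m + 1))" "even (i + (k + 2) + m)"
          using k(3) by auto
        have IH: "v' (base_point l i' m') = v (base_point l i' m')"
          if "l \<in> {k, k + 1}" "even (i' + l + m')" for l i' m'
        proof -
          have "l < j" "3 \<le> l" "l \<le> n + 3" using that(1) k j by auto
          from less.IH[OF this] that(2) show ?thesis by blast
        qed
        have ne: "(i + 3) mod 4 \<noteq> i mod 4" "(m + 5) mod 6 \<noteq> m mod 6" "(m + 1) mod 6 \<noteq> m mod 6"
            "(m + 5) mod 6 \<noteq> (m + 1) mod 6"
          by (rule add_mod_neq, simp, simp)+ (rule add_5_mod_6_neq)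
        \<comment> \<open>Of the three steps down from the top vertex, one changes the sheet and the
          other two change the phase, by 5 and by 1.\<close>
        have "v' (base_point (k + 2) i m) = v (base_point (k + 2) i m)"
        proof (rule realizes_squares_determine[OF r r' polytope_tower
              square12[OF k c(2)] square12[OF k c(1)] square23[OF k]])
          show "base_point (k + 1) i (m + 1) \<notin> {base_point (k + 2) i m, base_point (k + 1) (i + 3) m,
              base_point (k + 1) i (m + 5), base_point k (i + 3) (m + 5)}"
            using k par' ne by (simp add: base_point_eq_iff)
          show "base_point (k + 1) i (m + 5) \<notin> {base_point (k + 2) i m, base_point (k + 1) (i + 3) m,
              base_point (k + 1) i (m + 1), base_point k (i + 3) (m + 1)}"
            using k par' ne by (simp add: base_point_eq_iff)
          show "base_point (k + 1) (i + 3) m \<notin> {base_point (k + 2) i m, base_point (k + 1) i (m + 5),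
              base_point (k + 1) i (m + 1), base_point k i m}"
            using k par' ne by (simp add: base_point_eq_iff)
          show "v' t = v t" if "t \<in> {base_point (k + 1) (i + 3) m, base_point (k + 1) i (m + 5),
              base_point (k + 1) i (m + 1), base_point k (i + 3) (m + 5),
              base_point k (i + 3) (m + 1), base_point k i m}" for t
            using that IH par' k by auto
        qed
        then show ?thesis using j by simp
      qed
    qed
  qed
  then show ?thesis using x agree unfolding vertices_tower by (auto simp: base_def)
qed

lemma apex_opposite_face:
  assumes "x \<in> apexes"
  shows "\<exists>F. F face_of tower n \<and> F \<inter> vertices (tower n) = vertices (tower n) - {x}"
proof -
  define F where "F = tower n \<inter> {y. (- x) \<bullet> y = 0}"
  have "F face_of tower n"
    unfolding F_def tower_def
    by (rule supporting_face) (use assms apex_inner apex_inner_base[of x _ n] in auto)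
  moreover have "F \<inter> vertices (tower n) = vertices (tower n) - {x}"
    using assms vertices_subset[of "tower n"] apex_inner apex_inner_base[of x _ n]
    by (auto simp: F_def vertices_tower)
  ultimately show ?thesis by blast
qed

lemma CARD_ge_4: "CARD('n) \<ge> 4"
proof -
  have "card {i0, i1, i2, i3} = 4" using distinct_axes by simp
  then show ?thesis by (metis card_mono finite subset_UNIV)
qed

lemma base_mono:
  assumes "m \<le> n" shows "base m \<subseteq> base n"
proof
  fix x assume "x \<in> base m"
  then obtain j i l where x: "x = base_point j i l" "3 \<le> j" "j \<le> m + 3" "even (i + j + l)"
    by (auto simp: base_def)
  show "x \<in> base n" unfolding x(1) by (rule base_pointI) (use x assms in auto)
qed

section \<open>Counting parameters\<close>

lemma tower_cell_dimension:
  assumes "n \<ge> 1" and lab: "vertex_labelling (tower n) p"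
    and f: "continuous_on (open_cube k) f" "inj_on f (open_cube k)"
      "f ` open_cube k \<subseteq> realization_space (tower n) p"
  shows "k \<le> 76 + CARD('n) * (CARD('n) + 1)"
proof -
  define N where "N = card (vertices (tower n))"
  define l where "l = inv_into {1..N} p"
  define I A where "I = {i \<in> {1..N}. p i \<in> base 1}" and "A = {i \<in> {1..N}. p i \<in> apexes}"
  have p: "inj_on p {1..N}" "p ` {1..N} = vertices (tower n)"
    using lab by (auto simp: vertex_labelling_def N_def bij_betw_def)
  have lp: "l (p i) = i" if "i \<in> {1..N}" for i
    using p(1) that by (simp add: l_def)
  have sub: "base 1 \<subseteq> vertices (tower n)" "apexes \<subseteq> vertices (tower n)"
    using base_mono[OF \<open>n \<ge> 1\<close>] by (auto simp: vertices_tower)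
  have "p ` {i \<in> {1..N}. p i \<in> X} = p ` {1..N} \<inter> X" for X by auto
  then have pI: "p ` I = base 1" and pA: "p ` A = apexes"
    using sub p(2) unfolding I_def A_def by (simp_all only: Int_absorb1)
  have "card I = card (p ` I)" "card A = card (p ` A)"
    by (rule card_image[symmetric], rule inj_on_subset[OF p(1)], force simp: I_def A_def)+
  then have card: "card I = 24" "card A = CARD('n) - 4"
    by (simp_all add: pI pA card_base card_apexes)
  have V: "f x \<in> {1..N} \<rightarrow>\<^sub>E sphere 0 1" "realizes (tower n) (\<lambda>y. f x (l y))" if "x \<in> open_cube k" for x
  proof -
    have x: "f x \<in> realization_space (tower n) p" using f(3) that by blast
    then show "f x \<in> {1..N} \<rightarrow>\<^sub>E sphere 0 1" unfolding realization_space_def N_def by blast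
    show "realizes (tower n) (\<lambda>y. f x (l y))"
      using realization_space_realizes[OF lab x] by (simp add: l_def N_def)
  qed
  have "\<exists>q\<le>5. q \<le> card I \<and> k + card I + card A
      \<le> (q + card A) * DIM((real ^ 'n) \<times> real) + (card I - q) * q"
  proof (rule cell_dimension_bound[OF _ _ _ f(1,2)])
    show "finite I" "finite A" by (auto simp: I_def A_def)
    show "I \<inter> A = {}" using base_apexes_disjoint by (auto simp: I_def A_def)
  next
    fix x i assume "x \<in> open_cube k" "i \<in> I \<union> A"
    then show "norm (f x i) = 1" using V(1) by (auto simp: I_def A_def PiE_def Pi_def)
  next
    fix x y assume x: "x \<in> open_cube k" and y: "y \<in> open_cube k"
      and eq: "\<And>i. i \<in> I \<union> A \<Longrightarrow> f x i = f y i"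
    have "f x (l z) = f y (l z)" if "z \<in> base 1 \<union> apexes" for z
    proof -
      have "z \<in> p ` (I \<union> A)" using that pI pA by blast
      then obtain i where "i \<in> I \<union> A" "z = p i" by blast
      then show ?thesis using eq lp[of i] by (auto simp: I_def A_def)
    qed
    then have "f x (l z) = f y (l z)" if "z \<in> vertices (tower n)" for z
      using realizes_tower_determined[OF V(2)[OF y] V(2)[OF x] \<open>n \<ge> 1\<close>] that by blast
    then have "f x i = f y i" if "i \<in> {1..N}" for i
      using lp[OF that] p(2) that by (metis imageI)
    then show "f x = f y" by (rule PiE_ext[OF V(1)[OF x] V(1)[OF y]])
  next
    fix x assume x: "x \<in> open_cube k"
    have "f x ` I = (\<lambda>y. f x (l y)) ` base 1"
      unfolding pI[symmetric] image_image by (rule image_cong) (auto simp: lp I_def)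
    \<comment> \<open>The apexes take up \<open>CARD('n) - 4\<close> of the
      \<open>CARD('n) + 1\<close> dimensions, which leaves 5.\<close>
    moreover have "dim ((\<lambda>y. f x (l y)) ` base 1) + card apexes \<le> DIM((real ^ 'n) \<times> real)"
      by (rule realizes_base_rank[OF V(2)[OF x] finite_apexes sub(2,1) _ apex_opposite_face])
        (use base_apexes_disjoint in auto)
    ultimately show "dim (f x ` I) \<le> 5"
      using CARD_ge_4 by (simp add: card_apexes)
  qed
  then obtain q where q: "q \<le> 5" "k + 24 + (CARD('n) - 4)
      \<le> (q + (CARD('n) - 4)) * (CARD('n) + 1) + (24 - q) * q"
    unfolding card by auto
  obtain e where e: "CARD('n) = e + 4" using CARD_ge_4 by (metis add.commute le_Suc_ex)
  \<comment> \<open>The bound on \<open>k\<close> increases with \<open>q\<close> in this range; at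
    \<open>q = 5\<close> it is exactly \<open>76 + CARD('n) * (CARD('n) + 1)\<close>.\<close>
  have "q = 0 \<or> q = 1 \<or> q = 2 \<or> q = 3 \<or> q = 4 \<or> q = 5" using q(1) by auto
  then show ?thesis
    using q(2) unfolding e by (elim disjE) (simp_all add: algebra_simps)
qed

lemma tower_realization_space_dim:
  assumes "n \<ge> 1" "vertex_labelling (tower n) p"
  shows "semialgebraic_dim {1..card (vertices (tower n))} (realization_space (tower n) p)
           \<le> enat (76 + CARD('n) * (CARD('n) + 1))"
  unfolding semialgebraic_dim_def
proof (rule Sup_least)
  fix t assume "t \<in> {enat k | k. \<exists>T\<subseteq>realization_space (tower n) p.
     semialgebraic {1..card (vertices (tower n))} T \<and>
     semialgebraic_homeomorphic {1..k} {1..card (vertices (tower n))} (open_cube k) T}"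
  then obtain k T where t: "t = enat k" and T: "T \<subseteq> realization_space (tower n) p"
    "semialgebraic_homeomorphic {1..k} {1..card (vertices (tower n))} (open_cube k) T"
    by blast
  then obtain f g where "homeomorphism (open_cube k) T f g"
    by (auto simp: semialgebraic_homeomorphic_def)
  then have "continuous_on (open_cube k) f" "inj_on f (open_cube k)" "f ` open_cube k = T"
    by (auto simp: homeomorphism_def intro: inj_on_inverseI)
  then have "k \<le> 76 + CARD('n) * (CARD('n) + 1)"
    using tower_cell_dimension[OF assms, of k f] T(1) by simp
  then show "t \<le> enat (76 + CARD('n) * (CARD('n) + 1))" by (simp add: t)
qed

end

theorem theorem1:
  fixes d :: nat
  assumes "CARD('n::finite) = d" and "d \<ge> 4"
  shows "\<exists>P :: nat \<Rightarrow> (real ^ 'n) set.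
    (\<forall>n\<ge>1.
       polytope (P n) \<and> aff_dim (P n) = int d \<and>
       card (vertices (P n)) = 12 * (n + 1) + d - 4 \<and>
       (\<forall>p. vertex_labelling (P n) p \<longrightarrow>
          semialgebraic_dim {1..card (vertices (P n))} (realization_space (P n) p)
            \<le> enat (76 + d * (d + 1)))) \<and>
    (\<forall>m\<ge>1. \<forall>n\<ge>1. m \<noteq> n \<longrightarrow> \<not> comb_equivalent (P m) (P n))"
proof -
  obtain xs where xs: "distinct xs" "set xs = (UNIV :: 'n set)"
    using finite_distinct_list[of "UNIV :: 'n set"] by auto
  then have "length xs \<ge> 4" using assms distinct_card[of xs] by simp
  then have "xs ! a \<noteq> xs ! b" if "a < 4" "b < 4" "a \<noteq> b" for a b
    using xs(1) that by (simp add: nth_eq_iff_index_eq)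
  then have "distinct [xs ! 0, xs ! 1, xs ! 2, xs ! 3]"
    by simp
  then obtain a0 a1 a2 a3 :: 'n where "distinct [a0, a1, a2, a3]" by blast
  then interpret four_axes a0 a1 a2 a3 by unfold_locales
  have card: "card (vertices (tower n)) = 12 * (n + 1) + d - 4" for n
    using assms by (simp add: card_vertices_tower)
  show ?thesis
  proof (intro exI[of _ tower] conjI allI impI)
    fix n p assume "n \<ge> 1" "vertex_labelling (tower n) p"
    then show "semialgebraic_dim {1..card (vertices (tower n))} (realization_space (tower n) p)
        \<le> enat (76 + d * (d + 1))"
      using tower_realization_space_dim assms(1) by simp
  next
    fix m n :: nat assume "m \<noteq> n"
    show "\<not> comb_equivalent (tower m) (tower n)"
    proof
      assume "comb_equivalent (tower m) (tower n)"
      from comb_equivalent_card_vertices[OF polytope_tower polytope_tower this]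
      show False using \<open>m \<noteq> n\<close> by (simp add: card_vertices_tower)
    qed
  qed (use assms(1) polytope_tower aff_dim_tower card in auto)
qed

end
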